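(* Let $\mathbb{F}$ be a field, let $r$ and $s$ be non-negative integers, and assume that $|\mathbb{F}|>2(r+s-1)$. Let $\mathcal{W}$ be an optimal affine space of invertible matrices of $\mathrm{M}_r(\mathbb{F})$, and $\mathcal{C}$ be an optimal affine space of invertible matrices of $\mathrm{A}_{2s}(\mathbb{F})$. Then $\mathcal{W}\bullet\mathcal{C}$ is an optimal affine space of invertible matrices of $\mathrm{A}_{2(r+s)}(\mathbb{F})$, and hence so is every subset of $\mathrm{A}_{2(r+s)}(\mathbb{F})$ that is congruent to it.
   Context: $\mathrm{M}_{k}(\mathbb{F})$ (resp. $\mathrm{M}_{k,l}(\mathbb{F})$) is the space of $k\times k$ (resp. $k\times l$) matrices over $\mathbb{F}$ and $\mathrm{A}_k(\mathbb{F})$ the space of $k\times k$ alternating matrices (skew-symmetric with zero diagonal). For $\mathcal{E}=\mathrm{M}_r(\mathbb{F})$ or $\mathcal{E}=\mathrm{A}_{2k}(\mathbb{F})$, an affine subspace of $\mathcal{E}$ consisting of invertible matrices is optimal when it has the greatest possible dimension among all affine subspaces of $\mathcal{E}$ consisting of invertible matrices. The $0\times0$ matrix is regarded as invertible. For subsets $\mathcal{W}\subseteq \mathrm{M}_r(\mathbb{F})$ and $\mathcal{C}\subseteq\mathrm{A}_{2s}(\mathbb{F})$, $$\mathcal{W}\bullet\mathcal{C}:=\left\{\begin{bmatrix}0_{r\times r}&0_{r\times 2s}&M\\ 0_{2s\times r}&C&B\\ -M^T&-B^T&D\end{bmatrix}\;\middle|\;(M,C,B,D)\in\mathcal{W}\times\mathcal{C}\times\mathrm{M}_{2s,r}(\mathbb{F})\times\mathrm{A}_r(\mathbb{F})\right\}.$$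 Two subsets $\mathcal{X},\mathcal{Y}$ of $\mathrm{M}_k(\mathbb{F})$ are congruent when $\mathcal{Y}=P\mathcal{X}P^T$ for some $P\in\mathrm{GL}_k(\mathbb{F})$. *)

theory Defs
  imports "Jordan_Normal_Form.VS_Connect"
begin

text \<open>
  Vector spaces are given as module records over the field of scalars \<open>class_ring\<close>, as in
  \<open>module_mat\<close>. Affine subspaces are nonempty by convention.
\<close>

definition affine_subspace :: "('a::field, 'v, 'm) module_scheme \<Rightarrow> 'v set \<Rightarrow> bool" where
  "affine_subspace V X \<longleftrightarrow>
    (\<exists>p\<in>carrier V. \<exists>S. subspace class_ring S V \<and> X = (\<lambda>v. p \<oplus>\<^bsub>V\<^esub> v) ` S)"

definition direction :: "('a::field, 'v, 'm) module_scheme \<Rightarrow> 'v set \<Rightarrow> 'v set" where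
  "direction V X = {x \<ominus>\<^bsub>V\<^esub> y | x y. x \<in> X \<and> y \<in> X}"

definition affine_dim :: "('a::field, 'v, 'm) module_scheme \<Rightarrow> 'v set \<Rightarrow> nat" where
  "affine_dim V X = vectorspace.dim class_ring (V\<lparr>carrier := direction V X\<rparr>)"

definition alternating_mats :: "nat \<Rightarrow> 'a::field mat set" where
  "alternating_mats k =
    {A \<in> carrier_mat k k. transpose_mat A = - A \<and> (\<forall>i<k. A $$ (i, i) = 0)}"

abbreviation mat_space :: "nat \<Rightarrow> ('a::field, 'a mat) module" where
  "mat_space k \<equiv> module_mat TYPE('a) k k"

abbreviation alternating_space :: "nat \<Rightarrow> ('a::field, 'a mat) module" where
  "alternating_space k \<equiv> (mat_space k)\<lparr>carrier := alternating_mats k\<rparr>"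

definition affine_space_of_invertibles :: "('a::field, 'a mat, 'm) module_scheme \<Rightarrow> 'a mat set \<Rightarrow> bool" where
  "affine_space_of_invertibles V X \<longleftrightarrow> affine_subspace V X \<and> (\<forall>A\<in>X. invertible_mat A)"

definition optimal :: "('a::field, 'a mat, 'm) module_scheme \<Rightarrow> 'a mat set \<Rightarrow> bool" where
  "optimal V X \<longleftrightarrow> affine_space_of_invertibles V X \<and>
    (\<forall>Y. affine_space_of_invertibles V Y \<longrightarrow> affine_dim V Y \<le> affine_dim V X)"

text \<open>
  The block matrix with rows \<open>[0, 0, M]\<close>, \<open>[0, C, B]\<close>, \<open>[-M\<^sup>T, -B\<^sup>T, D]\<close>:
  its last block column is \<open>M\<close> over \<open>B\<close> over \<open>D\<close>, and \<open>[-M\<^sup>T, -B\<^sup>T]\<close> is the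
  negated transpose of \<open>M\<close> over \<open>B\<close>.
\<close>

definition bullet_mat :: "nat \<Rightarrow> nat \<Rightarrow> 'a::field mat \<Rightarrow> 'a mat \<Rightarrow> 'a mat \<Rightarrow> 'a mat \<Rightarrow> 'a mat" where
  "bullet_mat r s M C B D =
    four_block_mat
      (four_block_mat (0\<^sub>m r r) (0\<^sub>m r (2 * s)) (0\<^sub>m (2 * s) r) C) (M @\<^sub>r B)
      (- transpose_mat (M @\<^sub>r B)) D"

definition bullet :: "nat \<Rightarrow> nat \<Rightarrow> 'a::field mat set \<Rightarrow> 'a mat set \<Rightarrow> 'a mat set" where
  "bullet r s \<W> \<C> = {bullet_mat r s M C B D | M C B D.
    M \<in> \<W> \<and> C \<in> \<C> \<and> B \<in> carrier_mat (2 * s) r \<and> D \<in> alternating_mats r}"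

definition congruent_sets :: "nat \<Rightarrow> 'a::field mat set \<Rightarrow> 'a mat set \<Rightarrow> bool" where
  "congruent_sets k X Y \<longleftrightarrow>
    (\<exists>P \<in> carrier_mat k k. invertible_mat P \<and> Y = (\<lambda>A. P * A * transpose_mat P) ` X)"

lemma alternating_mats_iff:
  "A \<in> alternating_mats k \<longleftrightarrow> A \<in> carrier_mat k k \<and>
    (\<forall>i<k. \<forall>j<k. A $$ (j, i) = - (A $$ (i, j))) \<and> (\<forall>i<k. A $$ (i, i) = 0)"
proof -
  have "transpose_mat A = - A \<longleftrightarrow> (\<forall>i<k. \<forall>j<k. A $$ (j, i) = - (A $$ (i, j)))"
    if A: "A \<in> carrier_mat k k"
  proof
    assume eq: "transpose_mat A = - A"
    show "\<forall>i<k. \<forall>j<k. A $$ (j, i) = - (A $$ (i, j))"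
    proof (intro allI impI)
      fix i j assume ij: "i < k" "j < k"
      have "A $$ (j, i) = transpose_mat A $$ (i, j)" using A ij by simp
      also have "\<dots> = (- A) $$ (i, j)" by (simp only: eq)
      also have "\<dots> = - (A $$ (i, j))" using A ij by simp
      finally show "A $$ (j, i) = - (A $$ (i, j))" .
    qed
  next
    assume eq: "\<forall>i<k. \<forall>j<k. A $$ (j, i) = - (A $$ (i, j))"
    show "transpose_mat A = - A"
    proof (rule eq_matI)
      fix i j assume "i < dim_row (- A)" "j < dim_col (- A)"
      then have ij: "i < k" "j < k" using A by auto
      have "transpose_mat A $$ (i, j) = A $$ (j, i)" using A ij by simp
      also have "\<dots> = - (A $$ (i, j))" using eq ij by blast
      also have "\<dots> = (- A) $$ (i, j)" using A ij by simp
      finally show "transpose_mat A $$ (i, j) = (- A) $$ (i, j)" .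
    qed (use A in auto)
  qed
  then show ?thesis
    unfolding alternating_mats_def by blast
qed

text \<open>The alternating matrices form a linear subspace, so the notions above apply to them.\<close>

lemma subspace_alternating_mats:
  "subspace class_ring (alternating_mats k) (mat_space k :: ('a::field, 'a mat) module)"
proof (intro subspace.intro submodule.intro)
  show vs: "vectorspace class_ring (mat_space k :: ('a, 'a mat) module)"
    by (rule matrix_vs)
  then show "module class_ring (mat_space k :: ('a, 'a mat) module)"
    by (rule vectorspace.axioms(1))
  show "alternating_mats k \<subseteq> carrier (mat_space k :: ('a, 'a mat) module)"
    unfolding module_mat_simps alternating_mats_def by blast
  show "\<zero>\<^bsub>mat_space k\<^esub> \<in> (alternating_mats k :: 'a mat set)"
    unfolding module_mat_simps alternating_mats_iff by simp
next
  fix A B :: "'a mat"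
  assume AB: "A \<in> alternating_mats k" "B \<in> alternating_mats k"
  then have carr: "A \<in> carrier_mat k k" "B \<in> carrier_mat k k"
    unfolding alternating_mats_def by blast+
  have "(A + B) $$ (j, i) = - ((A + B) $$ (i, j))" if "i < k" "j < k" for i j
  proof -
    have *: "A $$ (j, i) = - (A $$ (i, j))" "B $$ (j, i) = - (B $$ (i, j))"
      using AB that unfolding alternating_mats_iff by blast+
    have "(A + B) $$ (j, i) = A $$ (j, i) + B $$ (j, i)" using carr that by simp
    also have "\<dots> = - (A $$ (i, j) + B $$ (i, j))" unfolding * by simp
    finally show ?thesis using carr that by simp
  qed
  moreover have "(A + B) $$ (i, i) = 0" if "i < k" for i
    using AB carr that unfolding alternating_mats_def by simp
  ultimately show "A \<oplus>\<^bsub>mat_space k\<^esub> B \<in> alternating_mats k"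
    unfolding module_mat_simps alternating_mats_iff using add_carrier_mat[OF carr(2)] by blast
next
  fix c :: 'a and A :: "'a mat"
  assume A: "A \<in> alternating_mats k"
  then have carr: "A \<in> carrier_mat k k"
    unfolding alternating_mats_def by blast
  have "(c \<cdot>\<^sub>m A) $$ (j, i) = - ((c \<cdot>\<^sub>m A) $$ (i, j))" if "i < k" "j < k" for i j
  proof -
    have *: "A $$ (j, i) = - (A $$ (i, j))"
      using A that unfolding alternating_mats_iff by blast
    have "(c \<cdot>\<^sub>m A) $$ (j, i) = c * A $$ (j, i)" using carr that by simp
    also have "\<dots> = - (c * A $$ (i, j))" unfolding * by simp
    finally show ?thesis using carr that by simp
  qed
  moreover have "(c \<cdot>\<^sub>m A) $$ (i, i) = 0" if "i < k" for i
    using A carr that unfolding alternating_mats_def by simp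
  ultimately show "c \<odot>\<^bsub>mat_space k\<^esub> A \<in> alternating_mats k"
    unfolding module_mat_simps alternating_mats_iff using smult_carrier_mat[OF carr] by blast
qed

lemma vectorspace_alternating_space:
  "vectorspace class_ring (alternating_space k :: ('a::field, 'a mat) module)"
  by (rule vectorspace.subspace_is_vs[OF matrix_vs subspace_alternating_mats])

lemma direction_translate:
  fixes V :: "('a::field, 'v, 'm) module_scheme"
  assumes S: "subspace class_ring S V" and p: "p \<in> carrier V"
  shows "direction V ((\<lambda>v. p \<oplus>\<^bsub>V\<^esub> v) ` S) = S"
proof -
  interpret S: subspace class_ring S V by fact
  interpret V: vectorspace class_ring V by (rule S.vs)
  interpret N: submodule class_ring S V by (rule S.submod)
  have SV: "x \<in> carrier V" if "x \<in> S" for x using N.subset that by auto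
  have diff: "(p \<oplus>\<^bsub>V\<^esub> x) \<ominus>\<^bsub>V\<^esub> (p \<oplus>\<^bsub>V\<^esub> y) = x \<ominus>\<^bsub>V\<^esub> y" if "x \<in> S" "y \<in> S" for x y
  proof -
    have "(p \<oplus>\<^bsub>V\<^esub> x) \<ominus>\<^bsub>V\<^esub> (p \<oplus>\<^bsub>V\<^esub> y) = (p \<oplus>\<^bsub>V\<^esub> \<ominus>\<^bsub>V\<^esub> p) \<oplus>\<^bsub>V\<^esub> (x \<oplus>\<^bsub>V\<^esub> \<ominus>\<^bsub>V\<^esub> y)"
      using SV[OF that(1)] SV[OF that(2)] p
      by (simp add: a_minus_def V.minus_add V.a_ac del: V.r_neg)
    then show ?thesis
      using SV[OF that(1)] SV[OF that(2)] p by (simp add: V.r_neg a_minus_def)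
  qed
  have neg: "\<ominus>\<^bsub>V\<^esub> y \<in> S" if "y \<in> S" for y
  proof -
    have "(- 1) \<odot>\<^bsub>V\<^esub> y \<in> S"
      by (rule N.smult_closed[OF _ that]) simp
    moreover have "(- 1) \<odot>\<^bsub>V\<^esub> y = \<ominus>\<^bsub>V\<^esub> y"
      using V.smult_minus_1[OF SV[OF that]] by (simp add: class_ring_simps)
    ultimately show ?thesis by (simp only:)
  qed
  have closed: "x \<ominus>\<^bsub>V\<^esub> y \<in> S" if "x \<in> S" "y \<in> S" for x y
    unfolding a_minus_def by (rule N.m_closed[OF that(1) neg[OF that(2)]])
  show ?thesis
  proof
    show "direction V ((\<lambda>v. p \<oplus>\<^bsub>V\<^esub> v) ` S) \<subseteq> S"
    proof
      fix d assume "d \<in> direction V ((\<lambda>v. p \<oplus>\<^bsub>V\<^esub> v) ` S)"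
      then obtain x y where "x \<in> S" "y \<in> S" "d = (p \<oplus>\<^bsub>V\<^esub> x) \<ominus>\<^bsub>V\<^esub> (p \<oplus>\<^bsub>V\<^esub> y)"
        unfolding direction_def by blast
      then show "d \<in> S" by (simp only: diff closed)
    qed
    show "S \<subseteq> direction V ((\<lambda>v. p \<oplus>\<^bsub>V\<^esub> v) ` S)"
    proof
      fix x assume x: "x \<in> S"
      have "x \<ominus>\<^bsub>V\<^esub> \<zero>\<^bsub>V\<^esub> = x"
        unfolding a_minus_def using SV[OF x] by simp
      then have "x = (p \<oplus>\<^bsub>V\<^esub> x) \<ominus>\<^bsub>V\<^esub> (p \<oplus>\<^bsub>V\<^esub> \<zero>\<^bsub>V\<^esub>)"
        by (simp only: diff[OF x N.zero_closed])
      then show "x \<in> direction V ((\<lambda>v. p \<oplus>\<^bsub>V\<^esub> v) ` S)"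
        unfolding direction_def using x N.zero_closed by blast
    qed
  qed
qed

end

(*
  An affine space p + S of invertible matrices in A_{2n} has dimension at most n(n-1), by induction on n.
  Choose x nonzero such that the rank of N |-> N x on S is maximal, and put y = p x. Invertibility keeps y
  out of S x. Since |F| exceeds the maximal rank, any N in S with N x = 0 maps everything into S x.
  Let R be a basis matrix of a complement of x in the hyperplane orthogonal to y. If N x = 0 and
  R^T N R = 0, then N has range in F y, which meets S x trivially, so N = 0. Hence S loses at most 2(n-1)
  dimensions on passing to {N. N x = 0}, and there N |-> R^T N R is injective with values in an affine
  space of invertible matrices of A_{2(n-1)}.

  In the other direction, the unipotent upper triangular matrices show dim W >= r(r-1)/2 (no upper bound
  in M_r is needed), their bullet product with the 0x0 matrix shows dim C >= s(s-1), and so the dimension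
  of the bullet product of W and C reaches n(n-1) for n = r + s.
*)
theory Submission
  imports "Jordan_Normal_Form.Char_Poly" Defs
begin

subsection \<open>Dimension of spaces of matrices\<close>

text \<open>The descent from n to n - 1 is symplectic reduction. If N x = 0 then (p + N) x = y, so
  the orthogonal of x for the form p + N is the hyperplane orthogonal to y, whichever such N is
  taken. This hyperplane contains x because the form is alternating, and the form induced on its
  quotient by x is again nondegenerate. One matrix R thus serves all these N at once. The obstacle
  is that the reduction sees N only on the hyperplane and only modulo F y; the maximality of the
  rank at x is there to make up for this loss. The constant 2(n - 1) is the dimension of the
  quotient. It bounds the rank at x, since S x lies in the orthogonal of x and meets the line F y of
  that orthogonal trivially. Hence it plays two parts: it is the loss of dimension in one step,
  giving 2(n - 1) + (n - 1)(n - 2) = n(n - 1), and it is the largest possible size of a matrix for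
  which some scalar must fail to be an eigenvalue, giving |F| > 2(n - 1). The condition on F is
  inherited by smaller n.\<close>

definition mat_subspace :: "nat \<Rightarrow> nat \<Rightarrow> 'a::field mat set \<Rightarrow> bool" where
  "mat_subspace nr nc S \<longleftrightarrow> S \<subseteq> carrier_mat nr nc \<and> 0\<^sub>m nr nc \<in> S \<and>
    (\<forall>A\<in>S. \<forall>B\<in>S. A + B \<in> S) \<and> (\<forall>c. \<forall>A\<in>S. c \<cdot>\<^sub>m A \<in> S)"

text \<open>Rectangular shapes are allowed because vectors and single entries enter the dimension
  counts as matrices with one column.\<close>

definition mat_dim :: "nat \<Rightarrow> nat \<Rightarrow> 'a::field mat set \<Rightarrow> nat" where
  "mat_dim nr nc S = vectorspace.dim class_ring ((module_mat TYPE('a) nr nc)\<lparr>carrier := S\<rparr>)"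

lemma mat_subspaceD:
  assumes "mat_subspace nr nc S"
  shows "S \<subseteq> carrier_mat nr nc" "0\<^sub>m nr nc \<in> S"
    "A \<in> S \<Longrightarrow> A \<in> carrier_mat nr nc"
    "A \<in> S \<Longrightarrow> B \<in> S \<Longrightarrow> A + B \<in> S" "A \<in> S \<Longrightarrow> c \<cdot>\<^sub>m A \<in> S"
  using assms unfolding mat_subspace_def by auto

lemma subspace_mat_iff:
  "subspace class_ring S (module_mat TYPE('a::field) nr nc) \<longleftrightarrow> mat_subspace nr nc S"
proof
  assume "subspace class_ring S (module_mat TYPE('a) nr nc)"
  then interpret s: submodule class_ring S "module_mat TYPE('a) nr nc"
    by (rule subspace.submod)
  show "mat_subspace nr nc S"
    using s.subset s.m_closed s.zero_closed s.smult_closed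
    unfolding mat_subspace_def by (auto simp: module_mat_simps class_ring_simps)
next
  assume S: "mat_subspace nr nc S"
  have vs: "vectorspace class_ring (module_mat TYPE('a) nr nc)" by (rule matrix_vs)
  show "subspace class_ring S (module_mat TYPE('a) nr nc)"
    by (intro subspace.intro submodule.intro vs vectorspace.axioms(1)[OF vs])
      (use S in \<open>auto simp: mat_subspace_def module_mat_simps class_ring_simps\<close>)
qed

lemma vectorspace_mat_subspace:
  assumes "mat_subspace nr nc (S :: 'a::field mat set)"
  shows "vectorspace class_ring ((module_mat TYPE('a) nr nc)\<lparr>carrier := S\<rparr>)"
  using assms subspace_mat_iff vectorspace.subspace_is_vs[OF matrix_vs] by blast

lemma subspace_mat_subspace_iff:
  assumes C: "mat_subspace nr nc (C :: 'a::field mat set)"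
  shows "subspace class_ring S ((module_mat TYPE('a) nr nc)\<lparr>carrier := C\<rparr>) \<longleftrightarrow>
    mat_subspace nr nc S \<and> S \<subseteq> C"
proof
  let ?V = "(module_mat TYPE('a) nr nc)\<lparr>carrier := C\<rparr>"
  assume "subspace class_ring S ?V"
  then interpret s: submodule class_ring S ?V
    by (rule subspace.submod)
  show "mat_subspace nr nc S \<and> S \<subseteq> C"
    using s.subset s.m_closed s.zero_closed s.smult_closed mat_subspaceD(1)[OF C]
    unfolding mat_subspace_def by (auto simp: module_mat_simps class_ring_simps)
next
  let ?V = "(module_mat TYPE('a) nr nc)\<lparr>carrier := C\<rparr>"
  assume S: "mat_subspace nr nc S \<and> S \<subseteq> C"
  have vs: "vectorspace class_ring ?V" by (rule vectorspace_mat_subspace[OF C])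
  show "subspace class_ring S ?V"
    by (intro subspace.intro submodule.intro vs vectorspace.axioms(1)[OF vs])
      (use S in \<open>auto simp: mat_subspace_def module_mat_simps class_ring_simps\<close>)
qed

lemma mat_subspace_carrier: "mat_subspace nr nc (carrier_mat nr nc)"
  by (auto simp: mat_subspace_def)

lemma linear_mapI:
  assumes "vectorspace K V" "vectorspace K W" "f \<in> module_hom K V W"
  shows "linear_map K V W f"
  using assms
  by (intro linear_map.intro mod_hom.intro mod_hom_axioms.intro vectorspace.axioms(1))

lemma fin_dim_module_mat: "vectorspace.fin_dim class_ring (module_mat TYPE('a::field) nr nc)"
  and dim_module_mat: "vectorspace.dim class_ring (module_mat TYPE('a::field) nr nc) = nr * nc"
proof -
  let ?V = "module_vec TYPE('a) (nr * nc)" and ?W = "module_mat TYPE('a) nr nc"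
  define T :: "'a vec \<Rightarrow> 'a mat" where "T v = mat nr nc (\<lambda>(i, j). v $ (i * nc + j))" for v
  have idx: "i * nc + j < nr * nc" if "i < nr" "j < nc" for i j
  proof -
    have "i * nc + j < Suc i * nc" using that by simp
    also have "\<dots> \<le> nr * nc" using that by (intro mult_le_mono1) simp
    finally show ?thesis .
  qed
  have "T \<in> module_hom class_ring ?V ?W"
    by (auto simp: module_hom_def module_mat_simps module_vec_simps T_def idx intro!: eq_matI)
  then have L: "linear_map class_ring ?V ?W T"
    by (rule linear_mapI[OF vec_vs matrix_vs])
  have inj: "inj_on T (carrier ?V)"
  proof (rule inj_onI)
    fix v w assume v: "v \<in> carrier ?V" and w: "w \<in> carrier ?V" and eq: "T v = T w"
    show "v = w"
    proof (rule eq_vecI)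
      show "dim_vec v = dim_vec w" using v w by (simp add: module_vec_simps)
      fix k assume "k < dim_vec w"
      then have k: "k < nr * nc" using w by (simp add: module_vec_simps)
      then have "nc > 0" by (cases nc) auto
      then have ij: "k div nc < nr" "k mod nc < nc"
        using k by (auto simp: less_mult_imp_div_less)
      have "T v $$ (k div nc, k mod nc) = T w $$ (k div nc, k mod nc)" using eq by simp
      then show "v $ k = w $ k" using ij by (simp add: T_def)
    qed
  qed
  have surj: "T ` carrier ?V = carrier ?W"
  proof
    show "T ` carrier ?V \<subseteq> carrier ?W" by (auto simp: T_def module_mat_simps)
    show "carrier ?W \<subseteq> T ` carrier ?V"
    proof
      fix A assume A: "A \<in> carrier ?W"
      define v where "v = vec (nr * nc) (\<lambda>k. A $$ (k div nc, k mod nc))"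
      have "T v = A"
        using A idx by (auto simp: T_def v_def module_mat_simps intro!: eq_matI)
      moreover have "v \<in> carrier ?V" by (simp add: v_def module_vec_simps)
      ultimately show "A \<in> T ` carrier ?V" by blast
    qed
  qed
  show "vectorspace.fin_dim class_ring ?W"
    by (rule linear_map.rank_nullity_main(2)[OF L vec_space.fin_dim surj])
  show "vectorspace.dim class_ring ?W = nr * nc"
    using linear_map.dim_eq[OF L vec_space.fin_dim inj surj] by (simp add: vec_space.dim_is_n)
qed

lemma mat_dim_carrier: "mat_dim nr nc (carrier_mat nr nc :: 'a::field mat set) = nr * nc"
proof -
  have "(module_mat TYPE('a) nr nc)\<lparr>carrier := carrier_mat nr nc\<rparr> = module_mat TYPE('a) nr nc"
    by (simp add: module_mat_def)
  then show ?thesis by (simp add: mat_dim_def dim_module_mat)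
qed

text \<open>Independence in \<open>S\<close> is independence in the ambient space, so independent
  subsets of \<open>S\<close> are bounded in size; a maximal one exists and is a basis.\<close>

lemma fin_dim_mat_subspace:
  assumes S: "mat_subspace nr nc (S :: 'a::field mat set)"
  shows "vectorspace.fin_dim class_ring ((module_mat TYPE('a) nr nc)\<lparr>carrier := S\<rparr>)"
proof -
  let ?V = "module_mat TYPE('a) nr nc" and ?S = "(module_mat TYPE('a) nr nc)\<lparr>carrier := S\<rparr>"
  interpret V: vectorspace class_ring ?V by (rule matrix_vs)
  interpret S: vectorspace class_ring ?S by (rule vectorspace_mat_subspace[OF S])
  have sub: "submodule class_ring S ?V"
    using S subspace_mat_iff subspace.submod by blast
  have SV: "S \<subseteq> carrier ?V" using mat_subspaceD(1)[OF S] by (simp add: module_mat_simps)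
  let ?P = "\<lambda>A. A \<subseteq> carrier ?S \<and> S.lin_indpt A"
  have "\<exists>A. finite A \<and> maximal A ?P"
  proof (rule maximal_exists)
    fix A assume A: "?P A"
    then have AS: "A \<subseteq> S" by simp
    have li: "V.lin_indpt A" using A V.span_li_not_depend(2)[OF AS sub] by simp
    show "finite A \<and> card A \<le> V.dim"
      using V.li_le_dim[OF fin_dim_module_mat _ li] AS SV by auto
  next
    show "?P {}" by (auto simp: S.lin_dep_def)
  qed
  then obtain A where A: "finite A" "maximal A ?P" by blast
  have "S.basis A" by (rule S.max_li_is_basis[OF A(2)])
  then show ?thesis using A(1) unfolding S.fin_dim_def S.basis_def by blast
qed

text \<open>The laws are required on \<open>S\<close> only. Dimensions are counted by splitting off
  the image of one map and interpreting the locale again on its kernel with the next map.\<close>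

locale mat_linear =
  fixes nr nc nr' nc' :: nat and S :: "'a::field mat set" and f :: "'a mat \<Rightarrow> 'a mat"
  assumes S: "mat_subspace nr nc S"
    and carrier: "\<And>A. A \<in> S \<Longrightarrow> f A \<in> carrier_mat nr' nc'"
    and add: "\<And>A B. A \<in> S \<Longrightarrow> B \<in> S \<Longrightarrow> f (A + B) = f A + f B"
    and smult: "\<And>c A. A \<in> S \<Longrightarrow> f (c \<cdot>\<^sub>m A) = c \<cdot>\<^sub>m f A"
begin

lemma linear_map:
  "linear_map class_ring ((module_mat TYPE('a) nr nc)\<lparr>carrier := S\<rparr>) (module_mat TYPE('a) nr' nc') f"
proof -
  have "f \<in> module_hom class_ring ((module_mat TYPE('a) nr nc)\<lparr>carrier := S\<rparr>) (module_mat TYPE('a) nr' nc')"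
    by (auto simp: module_hom_def module_mat_simps carrier add smult)
  then show ?thesis
    by (rule linear_mapI[OF vectorspace_mat_subspace[OF S] matrix_vs])
qed

lemma subspace_image: "mat_subspace nr' nc' (f ` S)"
  using linear_map.imT_is_subspace[OF linear_map] mod_hom.im_def[OF linear_map.axioms(3)[OF linear_map]]
  by (simp add: subspace_mat_iff)

lemma subspace_kernel: "mat_subspace nr nc {A \<in> S. f A = 0\<^sub>m nr' nc'}"
  and rank_nullity: "mat_dim nr nc S = mat_dim nr' nc' (f ` S) + mat_dim nr nc {A \<in> S. f A = 0\<^sub>m nr' nc'}"
proof -
  interpret L: linear_map class_ring "(module_mat TYPE('a) nr nc)\<lparr>carrier := S\<rparr>" "module_mat TYPE('a) nr' nc'" f
    by (rule linear_map)
  have ker: "L.kerT = {A \<in> S. f A = 0\<^sub>m nr' nc'}"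
    by (simp add: L.ker_def module_mat_simps)
  show "mat_subspace nr nc {A \<in> S. f A = 0\<^sub>m nr' nc'}"
    using L.kerT_is_subspace unfolding ker subspace_mat_subspace_iff[OF S] by simp
  have im: "L.imT = f ` S" by (simp add: L.im_def)
  show "mat_dim nr nc S = mat_dim nr' nc' (f ` S) + mat_dim nr nc {A \<in> S. f A = 0\<^sub>m nr' nc'}"
    using L.rank_nullity[OF fin_dim_mat_subspace[OF S]] unfolding ker im mat_dim_def by simp
qed

end

text \<open>Image and kernel of the identity are both the zero space, so rank-nullity reads d = d +
  d.\<close>

lemma mat_dim_zero: "mat_dim nr nc {0\<^sub>m nr nc :: 'a::field mat} = 0"
proof -
  interpret mat_linear nr nc nr nc "{0\<^sub>m nr nc :: 'a mat}" "\<lambda>A. A"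
    by unfold_locales (auto simp: mat_subspace_def)
  show ?thesis using rank_nullity by (simp add: Collect_conv_if)
qed

lemma (in mat_linear) dim_image_inj:
  assumes "\<And>A. A \<in> S \<Longrightarrow> f A = 0\<^sub>m nr' nc' \<Longrightarrow> A = 0\<^sub>m nr nc"
  shows "mat_dim nr' nc' (f ` S) = mat_dim nr nc S"
proof -
  \<comment> \<open>Homogeneity with scalar 0 yields that \<open>f\<close> maps zero to
    zero.\<close>
  have "f (0 \<cdot>\<^sub>m 0\<^sub>m nr nc) = 0 \<cdot>\<^sub>m f (0\<^sub>m nr nc)" by (rule smult[OF mat_subspaceD(2)[OF S]])
  moreover have "0 \<cdot>\<^sub>m f (0\<^sub>m nr nc) = 0\<^sub>m nr' nc'"
    using carrier[OF mat_subspaceD(2)[OF S]] by (auto intro!: eq_matI)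
  moreover have "0 \<cdot>\<^sub>m 0\<^sub>m nr nc = (0\<^sub>m nr nc :: 'a mat)" by auto
  ultimately have "f (0\<^sub>m nr nc) = 0\<^sub>m nr' nc'" by simp
  then have "0\<^sub>m nr nc \<in> {A \<in> S. f A = 0\<^sub>m nr' nc'}"
    using mat_subspaceD(2)[OF S] by blast
  then have "{A \<in> S. f A = 0\<^sub>m nr' nc'} = {0\<^sub>m nr nc}"
    using assms by blast
  then show ?thesis using rank_nullity by (simp add: mat_dim_zero)
qed

lemma mat_dim_mono:
  assumes S: "mat_subspace nr nc S" and T: "mat_subspace nr nc T" and sub: "S \<subseteq> T"
  shows "mat_dim nr nc (S :: 'a::field mat set) \<le> mat_dim nr nc T"
proof -
  let ?V = "(module_mat TYPE('a) nr nc)\<lparr>carrier := T\<rparr>"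
  let ?S = "(module_mat TYPE('a) nr nc)\<lparr>carrier := S\<rparr>"
  interpret V: vectorspace class_ring ?V by (rule vectorspace_mat_subspace[OF T])
  interpret S: vectorspace class_ring ?S by (rule vectorspace_mat_subspace[OF S])
  have "subspace class_ring S ?V" using S sub by (simp add: subspace_mat_subspace_iff[OF T])
  then have subm: "submodule class_ring S ?V" by (rule subspace.submod)
  obtain b where b: "finite b" "S.basis b"
    using S.finite_basis_exists[OF fin_dim_mat_subspace[OF S]] by blast
  then have bS: "b \<subseteq> S" by (simp add: S.basis_def)
  then have "V.lin_indpt b"
    using b V.span_li_not_depend(2)[OF bS subm] by (simp add: S.basis_def)
  then have "card b \<le> V.dim"
    using V.li_le_dim(2)[OF fin_dim_mat_subspace[OF T]] bS sub by auto
  then show ?thesis using S.dim_basis[OF b] by (simp add: mat_dim_def)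
qed

section \<open>Matrices with prescribed support\<close>

definition supported_mats :: "nat \<Rightarrow> nat \<Rightarrow> (nat \<times> nat) set \<Rightarrow> 'a::field mat set" where
  "supported_mats nr nc I = {A \<in> carrier_mat nr nc. \<forall>i<nr. \<forall>j<nc. (i, j) \<notin> I \<longrightarrow> A $$ (i, j) = 0}"

lemma mat_subspace_supported: "mat_subspace nr nc (supported_mats nr nc I)"
  by (auto simp: mat_subspace_def supported_mats_def)

text \<open>Reading the entry at a new position is onto the 1 x 1 matrices, and its kernel is the
  space supported on the other positions; so each position adds one dimension.\<close>

lemma mat_dim_supported:
  assumes "finite I" "I \<subseteq> {..<nr} \<times> {..<nc}"
  shows "mat_dim nr nc (supported_mats nr nc I :: 'a::field mat set) = card I"
  using assms
proof (induction I)
  case empty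
  have "supported_mats nr nc {} = {0\<^sub>m nr nc :: 'a mat}"
    by (auto simp: supported_mats_def intro!: eq_matI)
  then show ?case by (simp add: mat_dim_zero)
next
  case (insert p I)
  obtain a b where p: "p = (a, b)" by (cases p)
  then have ab: "a < nr" "b < nc" using insert.prems by auto
  let ?S = "supported_mats nr nc (insert p I) :: 'a mat set"
  define f :: "'a mat \<Rightarrow> 'a mat" where "f A = mat 1 1 (\<lambda>_. A $$ (a, b))" for A
  interpret mat_linear nr nc 1 1 ?S f
  proof
    show "mat_subspace nr nc ?S" by (rule mat_subspace_supported)
  qed (use ab in \<open>auto simp: f_def supported_mats_def intro!: eq_matI\<close>)
  have "f ` ?S = carrier_mat 1 1"
  proof
    show "f ` ?S \<subseteq> carrier_mat 1 1" using carrier by auto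
    show "carrier_mat 1 1 \<subseteq> f ` ?S"
    proof
      fix B :: "'a mat" assume B: "B \<in> carrier_mat 1 1"
      define A where "A = mat nr nc (\<lambda>q. if q = (a, b) then B $$ (0, 0) else 0)"
      have "A \<in> ?S" by (auto simp: A_def supported_mats_def p)
      moreover have "f A = B" using B ab by (auto simp: A_def f_def intro!: eq_matI)
      ultimately show "B \<in> f ` ?S" by blast
    qed
  qed
  moreover have "{A \<in> ?S. f A = 0\<^sub>m 1 1} = supported_mats nr nc I"
  proof -
    have "f A = 0\<^sub>m 1 1 \<longleftrightarrow> A $$ (a, b) = 0" for A
    proof
      assume "f A = 0\<^sub>m 1 1"
      then have "f A $$ (0, 0) = 0" by simp
      then show "A $$ (a, b) = 0" by (simp add: f_def)
    qed (auto simp: f_def)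
    then show ?thesis
      using ab insert.hyps p by (auto simp: supported_mats_def)
  qed
  ultimately show ?case using rank_nullity insert mat_dim_carrier[of 1 1, where 'a='a] by simp
qed

subsection \<open>Invertible and alternating matrices\<close>

lemma invertible_mat_iff_trivial_kernel:
  assumes A: "(A :: 'a::field mat) \<in> carrier_mat n n"
  shows "invertible_mat A \<longleftrightarrow> (\<forall>v\<in>carrier_vec n. A *\<^sub>v v = 0\<^sub>v n \<longrightarrow> v = 0\<^sub>v n)"
proof
  assume "invertible_mat A"
  then obtain B where AB: "A * B = 1\<^sub>m n" "B * A = 1\<^sub>m (dim_row B)"
    using A by (auto simp: invertible_mat_def inverts_mat_def)
  \<comment> \<open>The definition of invertibility does not fix the shape of \<open>B\<close>;
    comparing the dimensions of both sides of the two products does.\<close>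
  have "dim_col B = n" using arg_cong[OF AB(1), of dim_col] by simp
  moreover have "dim_row B = n" using arg_cong[OF AB(2), of dim_col] A by simp
  ultimately have B: "B \<in> carrier_mat n n" by auto
  show "\<forall>v\<in>carrier_vec n. A *\<^sub>v v = 0\<^sub>v n \<longrightarrow> v = 0\<^sub>v n"
  proof (intro ballI impI)
    fix v assume v: "v \<in> carrier_vec n" "A *\<^sub>v v = 0\<^sub>v n"
    have "B *\<^sub>v (A *\<^sub>v v) = (B * A) *\<^sub>v v" using A B v(1) by (simp add: assoc_mult_mat_vec)
    also have "\<dots> = v" using AB B v(1) by simp
    finally show "v = 0\<^sub>v n" using v(2) B by auto
  qed
next
  assume "\<forall>v\<in>carrier_vec n. A *\<^sub>v v = 0\<^sub>v n \<longrightarrow> v = 0\<^sub>v n"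
  then have "det A \<noteq> 0" using det_0_iff_vec_prod_zero_field[OF A] by blast
  then have "A \<in> Units (ring_mat TYPE('a) n undefined)" by (rule det_non_zero_imp_unit[OF A])
  then obtain B where "B \<in> carrier_mat n n" "B * A = 1\<^sub>m n" "A * B = 1\<^sub>m n"
    by (auto simp: Units_def ring_mat_simps)
  then show "invertible_mat A" using A by (auto simp: invertible_mat_def inverts_mat_def)
qed

lemma mat_eq_zeroI:
  assumes A: "(A :: 'a::field mat) \<in> carrier_mat n m"
    and "\<And>v. v \<in> carrier_vec m \<Longrightarrow> A *\<^sub>v v = 0\<^sub>v n"
  shows "A = 0\<^sub>m n m"
proof (rule eq_matI)
  fix i j assume "i < dim_row (0\<^sub>m n m :: 'a mat)" "j < dim_col (0\<^sub>m n m :: 'a mat)"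
  then have ij: "i < n" "j < m" by auto
  have "A $$ (i, j) = (A *\<^sub>v unit_vec m j) $ i" using A ij by simp
  then show "A $$ (i, j) = 0\<^sub>m n m $$ (i, j)" using assms(2)[of "unit_vec m j"] ij by simp
qed (use A in auto)

section \<open>Alternating matrices as bilinear forms\<close>

lemma alternating_matsD:
  assumes "A \<in> alternating_mats k"
  shows "A \<in> carrier_mat k k" "transpose_mat A = - A" "i < k \<Longrightarrow> A $$ (i, i) = 0"
    "i < k \<Longrightarrow> j < k \<Longrightarrow> A $$ (j, i) = - A $$ (i, j)"
proof -
  show "A \<in> carrier_mat k k" "transpose_mat A = - A" "i < k \<Longrightarrow> A $$ (i, i) = 0"
    using assms by (simp_all add: alternating_mats_def)
  show "i < k \<Longrightarrow> j < k \<Longrightarrow> A $$ (j, i) = - A $$ (i, j)"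
    using assms unfolding alternating_mats_iff by blast
qed

lemma alternating_mats_form_swap:
  assumes A: "A \<in> alternating_mats k" and u: "u \<in> carrier_vec k" and v: "v \<in> carrier_vec k"
  shows "u \<bullet> (A *\<^sub>v v) = - (v \<bullet> (A *\<^sub>v u))"
proof -
  note C = alternating_matsD(1)[OF A]
  have "u \<bullet> (A *\<^sub>v v) = (transpose_mat A *\<^sub>v u) \<bullet> v"
    by (rule transpose_vec_mult_scalar[OF C v u, symmetric])
  also have "\<dots> = - ((A *\<^sub>v u) \<bullet> v)"
    using C u v by (simp add: alternating_matsD(2)[OF A] uminus_mult_mat_vec)
  finally show ?thesis using C u v by (simp add: comm_scalar_prod[of "A *\<^sub>v u" k v])
qed

text \<open>Comparing the sum with its negative proves nothing in characteristic two. Instead the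
  induction cancels the last row against the last column, and the remaining diagonal term is
  zero.\<close>

lemma alternating_sum_eq_zero:
  fixes f :: "nat \<Rightarrow> nat \<Rightarrow> 'a::comm_ring"
  assumes "\<And>i j. i < k \<Longrightarrow> j < k \<Longrightarrow> f j i = - f i j" "\<And>i. i < k \<Longrightarrow> f i i = 0"
  shows "(\<Sum>i<k. \<Sum>j<k. f i j) = 0"
  using assms
proof (induction k)
  case (Suc k)
  have "(\<Sum>i<k. f k i) = (\<Sum>i<k. - f i k)" by (intro sum.cong refl Suc.prems(1)) auto
  moreover have "(\<Sum>i<k. \<Sum>j<k. f i j) = 0"
    by (rule Suc.IH; rule Suc.prems; simp)
  ultimately show ?case using Suc.prems(2)[of k] by (simp add: sum.distrib sum_negf)
qed simp

lemma alternating_mats_form_self: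
  assumes A: "A \<in> alternating_mats k" and v: "v \<in> carrier_vec k"
  shows "v \<bullet> (A *\<^sub>v v) = 0"
proof -
  note C = alternating_matsD(1)[OF A]
  have "v \<bullet> (A *\<^sub>v v) = (\<Sum>i<k. \<Sum>j<k. v $ i * A $$ (i, j) * v $ j)"
    using C v by (simp add: scalar_prod_def sum_distrib_left mult.assoc atLeast0LessThan)
  also have "\<dots> = 0"
  proof (rule alternating_sum_eq_zero)
    fix i j assume "i < k" "j < k"
    then show "v $ j * A $$ (j, i) * v $ i = - (v $ i * A $$ (i, j) * v $ j)"
      by (simp add: alternating_matsD(4)[OF A, of i j] mult_ac)
  qed (simp add: alternating_matsD(3)[OF A])
  finally show ?thesis .
qed

lemma alternating_mats_congruence:
  assumes A: "A \<in> alternating_mats n" and R: "R \<in> carrier_mat n m"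
  shows "transpose_mat R * A * R \<in> alternating_mats m"
proof -
  note C = alternating_matsD(1)[OF A]
  have "transpose_mat (transpose_mat R * A * R) = transpose_mat R * (transpose_mat A * R)"
    using transpose_mult[of "transpose_mat R * A" m n R m] transpose_mult[of "transpose_mat R" m n A n] C R
    by simp
  also have "\<dots> = - (transpose_mat R * A * R)"
    using C R by (simp add: alternating_matsD(2)[OF A] assoc_mult_mat[of _ m n _ n _ m])
  finally have "transpose_mat (transpose_mat R * A * R) = - (transpose_mat R * A * R)" .
  \<comment> \<open>The diagonal must be treated separately because of characteristic two: its i-th
    entry is the form of \<open>A\<close> evaluated twice at the i-th column of
    \<open>R\<close>.\<close>
  moreover have "(transpose_mat R * A * R) $$ (i, i) = 0" if i: "i < m" for i
  proof -
    have "(transpose_mat R * A * R) $$ (i, i) = (transpose_mat R * (A * R)) $$ (i, i)"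
      using C R by (simp add: assoc_mult_mat[of _ m n _ n _ m])
    also have "\<dots> = col R i \<bullet> (A *\<^sub>v col R i)"
      using C R i by (simp add: col_mult2[OF C R])
    also have "\<dots> = 0" by (rule alternating_mats_form_self[OF A]) (use R in auto)
    finally show ?thesis .
  qed
  ultimately show ?thesis using C R by (simp add: alternating_mats_def)
qed

subsection \<open>Vectors of maximal rank\<close>

text \<open>Families instead of sets: a repeated vector has to count as dependent, and relations are
  handled through coefficients indexed by position.\<close>

definition indep_family :: "nat \<Rightarrow> nat \<Rightarrow> (nat \<Rightarrow> 'a::field vec) \<Rightarrow> bool" where
  "indep_family m k v \<longleftrightarrow>
    (\<forall>c. (\<forall>j<m. (\<Sum>i<k. c i * v i $ j) = 0) \<longrightarrow> (\<forall>i<k. c i = 0))"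

lemma indep_familyD:
  assumes "indep_family m k v" "\<And>j. j < m \<Longrightarrow> (\<Sum>i<k. c i * v i $ j) = 0" "i < k"
  shows "c i = 0"
  using assms unfolding indep_family_def by blast

text \<open>The rows \<open>l i\<close> are functionals dual to the family. They are built one
  vector at a time, as in a Gaussian elimination: a functional \<open>e\<close> for the new vector
  is found first, then the old ones are corrected by multiples of it.\<close>

lemma indep_family_left_inverse:
  assumes "indep_family m k v"
  shows "\<exists>l. \<forall>i<k. \<forall>i'<k. (\<Sum>j<m. l i j * v i' $ j) = (if i = i' then 1 else 0)"
  using assms
proof (induction k)
  case (Suc k)
  have "indep_family m k v" unfolding indep_family_def
  proof (intro allI impI)
    fix c i assume c: "\<forall>j<m. (\<Sum>i<k. c i * v i $ j) = 0" and i: "i < k"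
    have "(c(k := 0)) i = 0" by (rule indep_familyD[OF Suc.prems]) (use c i in simp_all)
    then show "c i = 0" using i by simp
  qed
  then obtain l where l: "\<And>i i'. i < k \<Longrightarrow> i' < k \<Longrightarrow> (\<Sum>j<m. l i j * v i' $ j) = (if i = i' then 1 else 0)"
    using Suc.IH by blast
  define a where "a i = (\<Sum>j<m. l i j * v k $ j)" for i
  \<comment> \<open>\<open>a i\<close> is the value of the i-th old functional at
    \<open>v k\<close>. If \<open>v k\<close> minus its projection onto the old vectors were zero,
    this would be a relation with coefficient 1 at \<open>k\<close>.\<close>
  have "\<exists>j0<m. v k $ j0 - (\<Sum>i<k. a i * v i $ j0) \<noteq> 0"
  proof (rule ccontr)
    assume "\<not> ?thesis"
    then have "\<forall>j<m. (\<Sum>i<Suc k. ((\<lambda>i. - a i)(k := 1)) i * v i $ j) = 0"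
      by (simp add: sum_negf)
    then have "((\<lambda>i. - a i)(k := 1)) k = 0" using Suc.prems unfolding indep_family_def by blast
    then show False by simp
  qed
  then obtain j0 where j0: "j0 < m" "v k $ j0 - (\<Sum>i<k. a i * v i $ j0) \<noteq> 0" by blast
  define u where "u = v k $ j0 - (\<Sum>i<k. a i * v i $ j0)"
  \<comment> \<open>As a functional, \<open>e\<close> projects away the old vectors, reads the
    coordinate \<open>j0\<close> of the remainder and divides by \<open>u\<close>; hence it is 0 on
    the old vectors and 1 on \<open>v k\<close>.\<close>
  define e where "e j = ((if j = j0 then 1 else 0) - (\<Sum>i<k. v i $ j0 * l i j)) / u" for j
  have e: "(\<Sum>j<m. e j * w $ j) = (w $ j0 - (\<Sum>i<k. v i $ j0 * (\<Sum>j<m. l i j * w $ j))) / u" for w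
  proof -
    have "(\<Sum>j<m. e j * w $ j) = (\<Sum>j<m. (if j = j0 then w $ j else 0) / u - (\<Sum>i<k. v i $ j0 * (l i j * w $ j)) / u)"
      by (intro sum.cong refl)
        (auto simp: e_def diff_divide_distrib left_diff_distrib sum_distrib_right mult.assoc)
    also have "\<dots> = w $ j0 / u - (\<Sum>j<m. \<Sum>i<k. v i $ j0 * (l i j * w $ j)) / u"
      using j0(1) by (simp add: sum_subtractf flip: sum_divide_distrib)
    also have "(\<Sum>j<m. \<Sum>i<k. v i $ j0 * (l i j * w $ j)) = (\<Sum>i<k. v i $ j0 * (\<Sum>j<m. l i j * w $ j))"
      by (subst sum.swap) (simp add: sum_distrib_left)
    finally show ?thesis by (simp add: diff_divide_distrib)
  qed
  have e_lt: "(\<Sum>j<m. e j * v i' $ j) = 0" if i': "i' < k" for i'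
  proof -
    have "(\<Sum>i<k. v i $ j0 * (\<Sum>j<m. l i j * v i' $ j)) = (\<Sum>i<k. if i = i' then v i $ j0 else 0)"
      by (intro sum.cong refl) (use i' in \<open>simp add: l\<close>)
    then show ?thesis using i' by (simp add: e)
  qed
  have e_k: "(\<Sum>j<m. e j * v k $ j) = 1"
    using j0(2) by (simp add: e u_def flip: a_def) (simp add: mult.commute)
  \<comment> \<open>Subtracting \<open>a i\<close> times \<open>e\<close> makes the i-th functional
    vanish at \<open>v k\<close> and leaves its values on the old vectors alone.\<close>
  define l' where "l' i j = (if i < k then l i j - a i * e j else e j)" for i j
  have "(\<Sum>j<m. l' i j * v i' $ j) = (if i = i' then 1 else 0)" if i: "i < Suc k" and i': "i' < Suc k" for i i'
  proof (cases "i < k")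
    case True
    then have "(\<Sum>j<m. l' i j * v i' $ j) = (\<Sum>j<m. l i j * v i' $ j) - a i * (\<Sum>j<m. e j * v i' $ j)"
      by (simp add: l'_def left_diff_distrib sum_subtractf sum_distrib_left mult.assoc)
    also have "\<dots> = (if i = i' then 1 else 0)"
      using True i' by (cases "i' = k") (auto simp: e_lt e_k l a_def)
    finally show ?thesis .
  next
    case False
    then show ?thesis using i i' by (cases "i' = k") (auto simp: l'_def e_lt e_k)
  qed
  then show ?case by blast
qed simp

lemma indep_family_le_dim:
  assumes "indep_family m k (v :: nat \<Rightarrow> 'a::field vec)"
  shows "k \<le> m"
proof -
  define f :: "'a mat \<Rightarrow> 'a mat" where "f C = mat m 1 (\<lambda>(j, _). \<Sum>i<k. C $$ (i, 0) * v i $ j)" for C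
  interpret mat_linear k 1 m 1 "carrier_mat k 1" f
    by unfold_locales
      (auto simp: mat_subspace_carrier f_def distrib_right sum.distrib sum_distrib_left mult.assoc intro!: eq_matI)
  have "mat_dim m 1 (f ` carrier_mat k 1) = mat_dim k 1 (carrier_mat k 1 :: 'a mat set)"
  proof (rule dim_image_inj)
    fix C assume C: "C \<in> carrier_mat k 1" and "f C = 0\<^sub>m m 1"
    then have "(\<Sum>i<k. C $$ (i, 0) * v i $ j) = 0" if "j < m" for j
    proof -
      have "(\<Sum>i<k. C $$ (i, 0) * v i $ j) = f C $$ (j, 0)" using that by (simp add: f_def)
      then show ?thesis using \<open>f C = 0\<^sub>m m 1\<close> that by simp
    qed
    then have "C $$ (i, 0) = 0" if "i < k" for i
      using that by (rule indep_familyD[OF assms])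
    then show "C = 0\<^sub>m k 1" using C by (auto intro!: eq_matI)
  qed
  moreover have "mat_dim m 1 (f ` carrier_mat k 1) \<le> mat_dim m 1 (carrier_mat m 1 :: 'a mat set)"
    by (rule mat_dim_mono[OF subspace_image mat_subspace_carrier]) (use carrier in auto)
  ultimately show ?thesis by (simp add: mat_dim_carrier)
qed

text \<open>Turns a linear combination of the vectors \<open>N i *\<^sub>v x\<close> into the value
  at \<open>x\<close> of a single element of \<open>S\<close>, the same element for all
  \<open>x\<close>.\<close>

lemma mat_subspace_combination:
  fixes N :: "nat \<Rightarrow> 'a::field mat"
  assumes S: "mat_subspace m n S" and N: "\<And>i. i < k \<Longrightarrow> N i \<in> S"
  shows "\<exists>N'\<in>S. \<forall>x\<in>carrier_vec n. \<forall>j<m. (N' *\<^sub>v x) $ j = (\<Sum>i<k. c i * (N i *\<^sub>v x) $ j)"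
  using N
proof (induction k)
  case 0
  show ?case by (rule bexI[OF _ mat_subspaceD(2)[OF S]]) auto
next
  case (Suc k)
  then obtain N' where N': "N' \<in> S"
    "\<And>x j. x \<in> carrier_vec n \<Longrightarrow> j < m \<Longrightarrow> (N' *\<^sub>v x) $ j = (\<Sum>i<k. c i * (N i *\<^sub>v x) $ j)"
    by (meson less_SucI)
  have Nk: "N k \<in> S" using Suc.prems by simp
  note C = mat_subspaceD(3)[OF S N'(1)] mat_subspaceD(3)[OF S Nk]
  have "((N' + c k \<cdot>\<^sub>m N k) *\<^sub>v x) $ j = (\<Sum>i<Suc k. c i * (N i *\<^sub>v x) $ j)"
    if x: "x \<in> carrier_vec n" and j: "j < m" for x j
    using C x j
    by (simp add: N'(2)[OF x j, symmetric] add_mult_distrib_mat_vec[of _ m n])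
  then show ?case
    using mat_subspaceD(4,5)[OF S] N'(1) Nk by blast
qed

lemma exists_not_eigenvalue:
  assumes K: "(K :: 'a::field mat) \<in> carrier_mat k k"
    and card: "infinite (UNIV :: 'a set) \<or> k < card (UNIV :: 'a set)"
  shows "\<exists>\<mu>. \<not> eigenvalue K \<mu>"
proof (rule ccontr)
  assume "\<not> ?thesis"
  then have roots: "{\<mu>. poly (char_poly K) \<mu> = 0} = UNIV"
    using eigenvalue_root_char_poly[OF K] by blast
  have deg: "degree (char_poly K) = k" "char_poly K \<noteq> 0"
    using degree_monic_char_poly[OF K] by auto
  then show False
    using poly_roots_finite[OF deg(2)] card_poly_roots_bound[OF deg(2)] card roots by simp
qed

text \<open>If \<open>M z\<close> were not in \<open>S x\<close>, the \<open>N i x\<close> together with \<open>M z\<close> would be independent. Then,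
  by maximality of the rank at \<open>z - \<mu> x\<close>, where \<open>M\<close> takes the value \<open>M z\<close>, the matrix of the \<open>N i z\<close>
  modulo \<open>M z\<close> has every scalar \<open>\<mu>\<close> as an eigenvalue, which is too many for its size \<open>k\<close>.\<close>

lemma maximal_rank_kernel_range:
  assumes S: "mat_subspace m n (S :: 'a::field mat set)"
    and N: "\<And>i. i < k \<Longrightarrow> N i \<in> S" and x: "x \<in> carrier_vec n"
    and indep: "indep_family m k (\<lambda>i. N i *\<^sub>v x)"
    and maximal: "\<And>x' N'. x' \<in> carrier_vec n \<Longrightarrow> (\<And>i. i < Suc k \<Longrightarrow> N' i \<in> S) \<Longrightarrow>
      \<not> indep_family m (Suc k) (\<lambda>i. N' i *\<^sub>v x')"
    and card: "infinite (UNIV :: 'a set) \<or> k < card (UNIV :: 'a set)"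
    and M: "M \<in> S" "M *\<^sub>v x = 0\<^sub>v m" and z: "z \<in> carrier_vec n"
  shows "\<exists>M'\<in>S. M *\<^sub>v z = M' *\<^sub>v x"
proof (rule ccontr)
  assume contr: "\<not> ?thesis"
  note NC = mat_subspaceD(3)[OF S N] and MC = mat_subspaceD(3)[OF S M(1)]
  define v where "v i = (if i < k then N i *\<^sub>v x else M *\<^sub>v z)" for i
  have "indep_family m (Suc k) v" unfolding indep_family_def
  proof (intro allI impI)
    fix c i assume c: "\<forall>j<m. (\<Sum>i<Suc k. c i * v i $ j) = 0" and i: "i < Suc k"
    then have eq: "(\<Sum>i<k. c i * (N i *\<^sub>v x) $ j) + c k * (M *\<^sub>v z) $ j = 0" if "j < m" for j
      using that by (simp add: v_def)
    have "c k = 0"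
    proof (rule ccontr)
      assume ck: "c k \<noteq> 0"
      obtain M' where M': "M' \<in> S"
        "\<And>j. j < m \<Longrightarrow> (M' *\<^sub>v x) $ j = (\<Sum>i<k. (- c i / c k) * (N i *\<^sub>v x) $ j)"
        using mat_subspace_combination[OF S N, of k "\<lambda>i. i" "\<lambda>i. - c i / c k"] x by blast
      have "M *\<^sub>v z = M' *\<^sub>v x"
      proof (rule eq_vecI)
        show "dim_vec (M *\<^sub>v z) = dim_vec (M' *\<^sub>v x)"
          using MC mat_subspaceD(3)[OF S M'(1)] by simp
        fix j assume "j < dim_vec (M' *\<^sub>v x)"
        then have j: "j < m" using mat_subspaceD(3)[OF S M'(1)] by simp
        have "(M' *\<^sub>v x) $ j = - (\<Sum>i<k. c i * (N i *\<^sub>v x) $ j) / c k"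
          by (simp add: M'(2)[OF j] sum_divide_distrib sum_negf)
        also have "\<dots> = (M *\<^sub>v z) $ j"
          using eq[OF j] ck by (simp add: field_simps eq_neg_iff_add_eq_0 neg_eq_iff_add_eq_0)
        finally show "(M *\<^sub>v z) $ j = (M' *\<^sub>v x) $ j" by simp
      qed
      then show False using contr M'(1) by blast
    qed
    then show "c i = 0"
      using i indep_familyD[OF indep, of c i] eq by (cases "i = k") auto
  qed
  then obtain l where l: "\<And>i i'. i < Suc k \<Longrightarrow> i' < Suc k \<Longrightarrow>
      (\<Sum>j<m. l i j * v i' $ j) = (if i = i' then 1 else 0)"
    using indep_family_left_inverse by blast
  \<comment> \<open>For \<open>i < k\<close> the functional \<open>l i\<close> is dual to the
    vectors \<open>N i *\<^sub>v x\<close> and vanishes at \<open>M *\<^sub>v z\<close>. So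
    \<open>K\<close> holds the coordinates of the \<open>N i' *\<^sub>v z\<close>, with the
    direction of \<open>M *\<^sub>v z\<close> divided out.\<close>
  define K where "K = mat k k (\<lambda>(i, i'). \<Sum>j<m. l i j * (N i' *\<^sub>v z) $ j)"
  have K: "K \<in> carrier_mat k k" by (simp add: K_def)
  have "eigenvalue K \<mu>" for \<mu>
  proof -
    define x' where "x' = z - \<mu> \<cdot>\<^sub>v x"
    define N' where "N' i = (if i < k then N i else M)" for i
    have x': "x' \<in> carrier_vec n" using x z by (simp add: x'_def)
    have "\<not> indep_family m (Suc k) (\<lambda>i. N' i *\<^sub>v x')"
      by (rule maximal[OF x']) (auto simp: N'_def N M(1))
    then obtain c i0 where c: "\<And>j. j < m \<Longrightarrow> (\<Sum>i<Suc k. c i * (N' i *\<^sub>v x') $ j) = 0"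
      and i0: "i0 < Suc k" "c i0 \<noteq> 0"
      unfolding indep_family_def by blast
    have Nx': "(N i *\<^sub>v x') $ j = (N i *\<^sub>v z) $ j - \<mu> * (N i *\<^sub>v x) $ j" if "i < k" "j < m" for i j
      using NC[OF that(1)] x z that(2) unfolding x'_def
      by (simp add: mult_minus_distrib_mat_vec[of _ m n] mult_mat_vec[of _ m n])
    have Mx': "(M *\<^sub>v x') $ j = (M *\<^sub>v z) $ j" if "j < m" for j
      using MC x z that M(2) unfolding x'_def
      by (simp add: mult_minus_distrib_mat_vec[of _ m n] mult_mat_vec[of _ m n])
    have eq: "(\<Sum>i<k. c i * ((N i *\<^sub>v z) $ j - \<mu> * (N i *\<^sub>v x) $ j)) + c k * (M *\<^sub>v z) $ j = 0"
      if "j < m" for j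
      using c[OF that] that by (simp add: N'_def Nx' Mx')
    let ?c = "vec k c"
    \<comment> \<open>If only the coefficient of \<open>M\<close> survived,
      \<open>M *\<^sub>v z\<close> would be zero, which is the zero element of \<open>S\<close>
      applied to \<open>x\<close>.\<close>
    have "?c \<noteq> 0\<^sub>v k"
    proof
      assume "?c = 0\<^sub>v k"
      then have c0: "c i = 0" if "i < k" for i using that by (metis index_vec index_zero_vec(1))
      then have ck: "c k \<noteq> 0" using i0 by (metis less_antisym)
      have "(M *\<^sub>v z) $ j = 0" if "j < m" for j using eq[OF that] ck by (simp add: c0)
      then have "M *\<^sub>v z = 0\<^sub>m m n *\<^sub>v x" using MC x by (auto intro!: eq_vecI)
      then show False using contr mat_subspaceD(2)[OF S] by blast
    qed
    moreover have "K *\<^sub>v ?c = \<mu> \<cdot>\<^sub>v ?c"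
    proof (rule eq_vecI)
      fix i assume "i < dim_vec (\<mu> \<cdot>\<^sub>v ?c)"
      then have i: "i < k" by simp
      \<comment> \<open>Applying \<open>l i\<close> to the relation: the part at \<open>z\<close>
        becomes row i of K c, the part at \<open>x\<close> becomes \<mu> times \<open>c i\<close> by
        duality, and the term with \<open>M\<close> disappears.\<close>
      have "0 = (\<Sum>j<m. l i j * ((\<Sum>i'<k. c i' * ((N i' *\<^sub>v z) $ j - \<mu> * (N i' *\<^sub>v x) $ j)) + c k * (M *\<^sub>v z) $ j))"
        by (simp add: eq)
      also have "\<dots> = (\<Sum>j<m. \<Sum>i'<k. c i' * (l i j * (N i' *\<^sub>v z) $ j))
          - (\<Sum>j<m. \<Sum>i'<k. \<mu> * c i' * (l i j * (N i' *\<^sub>v x) $ j)) + (\<Sum>j<m. c k * (l i j * (M *\<^sub>v z) $ j))"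
        by (simp add: distrib_left sum.distrib right_diff_distrib sum_subtractf sum_distrib_left mult_ac)
      also have "(\<Sum>j<m. \<Sum>i'<k. c i' * (l i j * (N i' *\<^sub>v z) $ j)) = (\<Sum>i'<k. c i' * K $$ (i, i'))"
        by (subst sum.swap) (simp add: K_def i sum_distrib_left)
      also have "(\<Sum>j<m. \<Sum>i'<k. \<mu> * c i' * (l i j * (N i' *\<^sub>v x) $ j)) =
          (\<Sum>i'<k. \<mu> * c i' * (\<Sum>j<m. l i j * v i' $ j))"
        by (subst sum.swap) (simp add: v_def sum_distrib_left)
      also have "\<dots> = (\<Sum>i'<k. if i' = i then \<mu> * c i' else 0)"
        by (intro sum.cong refl) (use i l in auto)
      also have "\<dots> = \<mu> * c i" using i by simp
      also have "(\<Sum>j<m. c k * (l i j * (M *\<^sub>v z) $ j)) = 0"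
        using l[of i k] i by (simp add: v_def flip: sum_distrib_left)
      finally have "(\<Sum>i'<k. c i' * K $$ (i, i')) = \<mu> * c i" by simp
      then show "(K *\<^sub>v ?c) $ i = (\<mu> \<cdot>\<^sub>v ?c) $ i"
        using K i by (simp add: scalar_prod_def atLeast0LessThan mult.commute)
    qed (use K in simp)
    ultimately show "eigenvalue K \<mu>"
      unfolding eigenvalue_def eigenvector_def using K by (intro exI[of _ ?c]) auto
  qed
  then show False using exists_not_eigenvalue[OF K card] by blast
qed

subsection \<open>Upper bound for the dimension\<close>

text \<open>Pick coordinates i and j with x_i and y_j nonzero. The complement consists of the
  vectors of the hyperplane whose i-th coordinate is 0: the coordinate j is then determined by
  orthogonality to \<open>y\<close>, and the other \<open>k\<close> coordinates are free. The last
  property says at once that \<open>R\<close> is injective and that its range avoids the line of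
  \<open>x\<close>.\<close>

lemma hyperplane_complement_basis:
  fixes x y :: "'a::field vec"
  assumes m: "m = k + 2" and x: "x \<in> carrier_vec m" "x \<noteq> 0\<^sub>v m" and y: "y \<in> carrier_vec m" "y \<noteq> 0\<^sub>v m"
    and xy: "x \<bullet> y = 0"
  obtains R where "R \<in> carrier_mat m k"
    "\<And>c. c \<in> carrier_vec k \<Longrightarrow> y \<bullet> (R *\<^sub>v c) = 0"
    "\<And>h. h \<in> carrier_vec m \<Longrightarrow> y \<bullet> h = 0 \<Longrightarrow> \<exists>c\<in>carrier_vec k. \<exists>\<mu>. h = R *\<^sub>v c + \<mu> \<cdot>\<^sub>v x"
    "\<And>c \<mu>. c \<in> carrier_vec k \<Longrightarrow> R *\<^sub>v c = \<mu> \<cdot>\<^sub>v x \<Longrightarrow> c = 0\<^sub>v k"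
proof -
  have "\<exists>i<m. x $ i \<noteq> 0" using x by (metis carrier_vecD eq_vecI index_zero_vec)
  then obtain i where i: "i < m" "x $ i \<noteq> 0" by blast
  \<comment> \<open>An index different from i is available because otherwise
    \<open>x \<bullet> y\<close> would be the single nonzero product x_i y_i.\<close>
  have "\<exists>j<m. j \<noteq> i \<and> y $ j \<noteq> 0"
  proof (rule ccontr)
    assume "\<not> ?thesis"
    then have y0: "y $ j = 0" if "j < m" "j \<noteq> i" for j using that by blast
    have "x \<bullet> y = (\<Sum>j<m. if j = i then x $ i * y $ i else 0)"
      unfolding scalar_prod_def using y y0 by (intro sum.cong) auto
    then have "y $ i = 0" using xy i by simp
    then have "y $ j = 0" if "j < m" for j using y0[OF that] by (cases "j = i") auto
    then have "y = 0\<^sub>v m" using y(1) by (intro eq_vecI) auto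
    then show False using y(2) by blast
  qed
  then obtain j where j: "j < m" "j \<noteq> i" "y $ j \<noteq> 0" by blast
  have "card ({..<m} - {i, j}) = card {..<k}" using i j m by (simp add: card_Diff_subset)
  then obtain \<sigma> where \<sigma>: "bij_betw \<sigma> {..<k} ({..<m} - {i, j})"
    using finite_same_card_bij[of "{..<k}" "{..<m} - {i, j}"] by auto
  have \<sigma>_range: "\<sigma> l < m" "\<sigma> l \<noteq> i" "\<sigma> l \<noteq> j" if "l < k" for l
    using bij_betwE[OF \<sigma>] that by auto
  have \<sigma>_inj: "\<sigma> l = \<sigma> l' \<longleftrightarrow> l = l'" if "l < k" "l' < k" for l l'
    using bij_betw_imp_inj_on[OF \<sigma>] that by (auto dest: inj_onD)
  have \<sigma>_cases: "a = i \<or> a = j \<or> (\<exists>l<k. a = \<sigma> l)" if "a < m" for a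
  proof -
    have "a \<in> {i, j} \<union> \<sigma> ` {..<k}" using bij_betw_imp_surj_on[OF \<sigma>] that by simp
    then show ?thesis by auto
  qed
  have sum_split: "(\<Sum>a<m. f a) = f i + f j + (\<Sum>l<k. f (\<sigma> l))" for f :: "nat \<Rightarrow> 'a"
  proof -
    have "{..<m} = insert i (insert j ({..<m} - {i, j}))" using i j by auto
    then have "(\<Sum>a<m. f a) = f i + (f j + (\<Sum>a\<in>{..<m} - {i, j}. f a))"
      using j(2) by (metis (no_types, lifting) Diff_iff finite_Diff finite_insert finite_lessThan insertCI insertE sum.insert)
    also have "(\<Sum>a\<in>{..<m} - {i, j}. f a) = (\<Sum>l<k. f (\<sigma> l))"
      by (rule sum.reindex_bij_betw[OF \<sigma>, symmetric])
    finally show ?thesis by (simp add: add.assoc)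
  qed
  \<comment> \<open>Column l is the unit vector at \<open>\<sigma> l\<close>, corrected in
    coordinate j so as to be orthogonal to \<open>y\<close>; row i is zero to separate the columns
    from \<open>x\<close>.\<close>
  define R where "R = mat m k (\<lambda>(a, l).
    if a = i then 0 else if a = j then - (y $ \<sigma> l / y $ j) else if a = \<sigma> l then 1 else 0)"
  have R: "R \<in> carrier_mat m k" by (simp add: R_def)
  have Ri: "(R *\<^sub>v c) $ i = 0" if "c \<in> carrier_vec k" for c
    using that i by (simp add: R_def scalar_prod_def)
  have Rj: "(R *\<^sub>v c) $ j = - (\<Sum>l<k. y $ \<sigma> l * c $ l) / y $ j" if "c \<in> carrier_vec k" for c
    using that j by (simp add: R_def scalar_prod_def sum_divide_distrib sum_negf atLeast0LessThan)
  have R\<sigma>: "(R *\<^sub>v c) $ \<sigma> l = c $ l" if "c \<in> carrier_vec k" "l < k" for c l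
  proof -
    have "(R *\<^sub>v c) $ \<sigma> l = (\<Sum>l'<k. (if l = l' then 1 else 0) * c $ l')"
      unfolding R_def using that \<sigma>_range[OF that(2)] \<sigma>_inj[OF that(2)]
      by (simp add: scalar_prod_def atLeast0LessThan del: sum.delta sum.delta')
    also have "\<dots> = (\<Sum>l'<k. if l' = l then c $ l' else 0)" by (intro sum.cong refl) simp
    finally show ?thesis using that by simp
  qed
  have prod: "u \<bullet> v = u $ i * v $ i + u $ j * v $ j + (\<Sum>l<k. u $ \<sigma> l * v $ \<sigma> l)"
    if "v \<in> carrier_vec m" for u v :: "'a vec"
    using that by (simp add: scalar_prod_def atLeast0LessThan sum_split)
  have Rc: "R *\<^sub>v c \<in> carrier_vec m" for c using R by (intro carrier_vecI) simp
  have a: "y \<bullet> (R *\<^sub>v c) = 0" if "c \<in> carrier_vec k" for c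
    using that j(3) by (simp add: prod[OF Rc] Ri Rj R\<sigma>)
  have b: "\<exists>c\<in>carrier_vec k. \<exists>\<mu>. h = R *\<^sub>v c + \<mu> \<cdot>\<^sub>v x"
    if h: "h \<in> carrier_vec m" "y \<bullet> h = 0" for h
  proof -
    \<comment> \<open>The multiple of \<open>x\<close> whose removal clears the i-th coordinate of
      \<open>h\<close>.\<close>
    define \<mu> where "\<mu> = h $ i / x $ i"
    define g where "g = h - \<mu> \<cdot>\<^sub>v x"
    define c where "c = vec k (\<lambda>l. g $ \<sigma> l)"
    have c: "c \<in> carrier_vec k" by (simp add: c_def)
    have g: "g \<in> carrier_vec m" using h x by (simp add: g_def)
    have gi: "g $ i = 0" using h x i by (simp add: g_def \<mu>_def)
    have "y \<bullet> g = y \<bullet> h - \<mu> * (y \<bullet> x)"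
      using h x y by (simp add: g_def scalar_prod_minus_distrib[of _ m])
    then have yg: "y \<bullet> g = 0" using h xy x y by (simp add: comm_scalar_prod[of y m x])
    then have gj: "g $ j = - (\<Sum>l<k. y $ \<sigma> l * g $ \<sigma> l) / y $ j"
      using j(3) by (simp add: prod[OF g] gi field_simps eq_neg_iff_add_eq_0)
    have "g = R *\<^sub>v c"
    proof (rule eq_vecI)
      fix a assume "a < dim_vec (R *\<^sub>v c)"
      then have "a < m" using R by simp
      from \<sigma>_cases[OF this] show "g $ a = (R *\<^sub>v c) $ a"
        by (auto simp: Ri[OF c] gi Rj[OF c] gj R\<sigma>[OF c]) (auto simp: c_def)
    qed (use g R in simp)
    moreover have "h = g + \<mu> \<cdot>\<^sub>v x"
      using h x by (auto simp: g_def intro!: eq_vecI)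
    ultimately show "\<exists>c\<in>carrier_vec k. \<exists>\<mu>. h = R *\<^sub>v c + \<mu> \<cdot>\<^sub>v x" using c by blast
  qed
  have d: "c = 0\<^sub>v k" if c: "c \<in> carrier_vec k" and eq: "R *\<^sub>v c = \<mu> \<cdot>\<^sub>v x" for c \<mu>
  proof -
    have "(R *\<^sub>v c) $ i = \<mu> * x $ i" using eq i x by simp
    then have "\<mu> = 0" using i Ri[OF c] by simp
    then have "(R *\<^sub>v c) $ \<sigma> l = 0" if "l < k" for l using eq x \<sigma>_range[OF that] by simp
    then show "c = 0\<^sub>v k" using c R\<sigma>[OF c] by (intro eq_vecI) auto
  qed
  show ?thesis by (rule that[OF R a b d])
qed

text \<open>Testing \<open>w\<close> on the vectors e_a - (y_a / y_j) e_j of the hyperplane, for a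
  fixed j with y_j nonzero, compares each coordinate of \<open>w\<close> with the j-th one.\<close>

lemma orthogonal_to_hyperplane:
  fixes y w :: "'a::field vec"
  assumes y: "y \<in> carrier_vec m" "y \<noteq> 0\<^sub>v m" and w: "w \<in> carrier_vec m"
    and orth: "\<And>h. h \<in> carrier_vec m \<Longrightarrow> y \<bullet> h = 0 \<Longrightarrow> h \<bullet> w = 0"
  shows "\<exists>\<mu>. w = \<mu> \<cdot>\<^sub>v y"
proof -
  have "\<exists>j<m. y $ j \<noteq> 0" using y by (metis carrier_vecD eq_vecI index_zero_vec)
  then obtain j where j: "j < m" "y $ j \<noteq> 0" by blast
  have "w $ a = w $ j / y $ j * y $ a" if a: "a < m" for a
  proof -
    define h where "h = unit_vec m a - (y $ a / y $ j) \<cdot>\<^sub>v unit_vec m j"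
    have h: "h \<in> carrier_vec m" by (simp add: h_def)
    have prod: "v \<bullet> h = v $ a - y $ a / y $ j * v $ j" if "v \<in> carrier_vec m" for v
      using that a j by (simp add: h_def scalar_prod_minus_distrib[of _ m])
    have "h \<bullet> w = 0" using orth[OF h] j prod[OF y(1)] by simp
    then have "w $ a - y $ a / y $ j * w $ j = 0"
      using prod[OF w] comm_scalar_prod[OF h w] by simp
    then show ?thesis by simp
  qed
  then have "w = (w $ j / y $ j) \<cdot>\<^sub>v y" using w y by (intro eq_vecI) auto
  then show ?thesis by blast
qed

lemma mat_subspace_alternating: "mat_subspace k k (alternating_mats k)"
  using subspace_alternating_mats by (simp add: subspace_mat_iff)

text \<open>The affine space is given by a base point \<open>P\<close> and a direction
  \<open>S\<close>, both of which are transported by the reduction. The cardinality condition is |F|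
  > 2(n - 1) freed of the subtraction, so that it makes sense for \<open>n = 0\<close> and passes to
  smaller \<open>n\<close>.\<close>

lemma dim_alternating_invertible_le:
  fixes P :: "'a::field mat"
  assumes "infinite (UNIV :: 'a set) \<or> 2 * n < card (UNIV :: 'a set) + 2"
    and "mat_subspace (2 * n) (2 * n) S" "S \<subseteq> alternating_mats (2 * n)"
    and "P \<in> alternating_mats (2 * n)" "\<And>N. N \<in> S \<Longrightarrow> invertible_mat (P + N)"
  shows "mat_dim (2 * n) (2 * n) S \<le> n * (n - 1)"
  using assms
proof (induction n arbitrary: S P)
  case 0
  then have "mat_dim (2 * 0) (2 * 0) S \<le> mat_dim (2 * 0) (2 * 0) (carrier_mat (2 * 0) (2 * 0) :: 'a mat set)"
    by (intro mat_dim_mono mat_subspace_carrier mat_subspaceD)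
  then show ?case by (simp add: mat_dim_carrier)
next
  case (Suc n)
  define k where "k = 2 * n"
  define m where "m = 2 * Suc n"
  have m: "m = k + 2" by (simp add: m_def k_def)
  have S: "mat_subspace m m S" and SA: "\<And>N. N \<in> S \<Longrightarrow> N \<in> alternating_mats m"
    and P: "P \<in> alternating_mats m" and inv: "\<And>N. N \<in> S \<Longrightarrow> invertible_mat (P + N)"
    using Suc.prems by (auto simp: m_def)
  note PC = alternating_matsD(1)[OF P] and SC = mat_subspaceD(3)[OF S]
  have inj: "v = 0\<^sub>v m" if "N \<in> S" "v \<in> carrier_vec m" "(P + N) *\<^sub>v v = 0\<^sub>v m" for N v
    using inv[OF that(1)] that PC SC[OF that(1)] invertible_mat_iff_trivial_kernel[of "P + N" m] by auto
  \<comment> \<open>\<open>Q \<rho>\<close> states that some nonzero vector has rank at least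
    \<open>\<rho>\<close>. The greatest such number is the maximal rank, and it exists because ranks
    are at most \<open>m\<close>.\<close>
  define Q where "Q \<rho> \<longleftrightarrow> (\<exists>x\<in>carrier_vec m. x \<noteq> 0\<^sub>v m \<and>
    (\<exists>N. (\<forall>i<\<rho>. N i \<in> S) \<and> indep_family m \<rho> (\<lambda>i. N i *\<^sub>v x)))" for \<rho>
  have "Q 0" unfolding Q_def
    by (rule bexI[of _ "unit_vec m 0"]) (auto simp: indep_family_def m unit_vec_nonzero)
  moreover have "\<forall>\<rho>. Q \<rho> \<longrightarrow> \<rho> < Suc m" by (auto simp: Q_def less_Suc_eq_le intro: indep_family_le_dim)
  ultimately obtain \<rho> where \<rho>: "Q \<rho>" "\<And>\<rho>'. Q \<rho>' \<Longrightarrow> \<rho>' \<le> \<rho>"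
    using ex_has_greatest_nat[of Q 0 "\<lambda>x. x" "Suc m"] by auto
  from \<rho>(1) obtain x N where x: "x \<in> carrier_vec m" "x \<noteq> 0\<^sub>v m"
    and N: "\<And>i. i < \<rho> \<Longrightarrow> N i \<in> S" and indep: "indep_family m \<rho> (\<lambda>i. N i *\<^sub>v x)"
    unfolding Q_def by blast
  define y where "y = P *\<^sub>v x"
  have y: "y \<in> carrier_vec m" using PC x by (simp add: y_def)
  have y_range: "\<mu> = 0" if M: "M \<in> S" "M *\<^sub>v x = \<mu> \<cdot>\<^sub>v y" for M \<mu>
  proof (rule ccontr)
    assume \<mu>: "\<mu> \<noteq> 0"
    \<comment> \<open>The element P - M / \<mu> of the affine space would have \<open>x\<close> in
      its kernel.\<close>
    have "(P + (- 1 / \<mu>) \<cdot>\<^sub>m M) *\<^sub>v x = y + (- 1 / \<mu>) \<cdot>\<^sub>v (M *\<^sub>v x)"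
      using PC SC[OF M(1)] x
      by (auto simp: y_def add_mult_distrib_mat_vec[of _ m m] intro!: eq_vecI)
    also have "\<dots> = 0\<^sub>v m" using \<mu> y by (auto simp: M(2) intro!: eq_vecI)
    finally show False
      using inj[OF mat_subspaceD(5)[OF S M(1)] x(1)] x(2) by blast
  qed
  have zero_mult: "0\<^sub>m i j *\<^sub>v v = 0\<^sub>v i" if "v \<in> carrier_vec j" for i j and v :: "'a vec"
    using that by (auto intro!: eq_vecI)
  have y0: "y \<noteq> 0\<^sub>v m"
    \<comment> \<open>If \<open>y\<close> were zero, the zero matrix would satisfy the premise of
      \<open>y_range\<close> with \<mu> = 1.\<close>
    using y_range[OF mat_subspaceD(2)[OF S], of 1] x y by (auto simp: zero_mult)
  have xy: "x \<bullet> y = 0" unfolding y_def by (rule alternating_mats_form_self[OF P x(1)])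
  obtain R where R: "R \<in> carrier_mat m k"
    and yR: "\<And>c. c \<in> carrier_vec k \<Longrightarrow> y \<bullet> (R *\<^sub>v c) = 0"
    and hyp: "\<And>h. h \<in> carrier_vec m \<Longrightarrow> y \<bullet> h = 0 \<Longrightarrow> \<exists>c\<in>carrier_vec k. \<exists>\<mu>. h = R *\<^sub>v c + \<mu> \<cdot>\<^sub>v x"
    and R_inj: "\<And>c \<mu>. c \<in> carrier_vec k \<Longrightarrow> R *\<^sub>v c = \<mu> \<cdot>\<^sub>v x \<Longrightarrow> c = 0\<^sub>v k"
    using hyperplane_complement_basis[OF m x y y0 xy] by blast
  have RT: "transpose_mat R \<in> carrier_mat k m" using R by simp
  have Rc: "R *\<^sub>v c \<in> carrier_vec m" for c using R by (intro carrier_vecI) simp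
  have RT_index: "(transpose_mat R *\<^sub>v w) $ j = (\<Sum>a<m. R $$ (a, j) * w $ a)"
    if "w \<in> carrier_vec m" "j < k" for w j
    using R that by (simp add: scalar_prod_def atLeast0LessThan)
  \<comment> \<open>The columns of \<open>R\<close> together with \<open>x\<close> span the
    hyperplane orthogonal to \<open>y\<close>; a vector orthogonal to all of them is orthogonal to
    that hyperplane.\<close>
  have multiple_y: "\<exists>\<mu>. w = \<mu> \<cdot>\<^sub>v y"
    if w: "w \<in> carrier_vec m" "transpose_mat R *\<^sub>v w = 0\<^sub>v k" "x \<bullet> w = 0" for w
  proof (rule orthogonal_to_hyperplane[OF y y0 w(1)])
    fix h assume h: "h \<in> carrier_vec m" "y \<bullet> h = 0"
    then obtain c \<mu> where c: "c \<in> carrier_vec k" and heq: "h = R *\<^sub>v c + \<mu> \<cdot>\<^sub>v x"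
      using hyp by blast
    have "(R *\<^sub>v c) \<bullet> w = w \<bullet> (R *\<^sub>v c)" by (rule comm_scalar_prod[OF Rc w(1)])
    also have "\<dots> = (transpose_mat R *\<^sub>v w) \<bullet> c"
      by (rule transpose_vec_mult_scalar[OF R c w(1), symmetric])
    also have "\<dots> = 0" using w(2) c by simp
    finally show "h \<bullet> w = 0"
      using Rc[of c] x w by (simp add: heq add_scalar_prod_distrib[of _ m])
  qed
  have x_range: "x \<bullet> (M *\<^sub>v x) = 0" if "M \<in> S" for M
    by (rule alternating_mats_form_self[OF SA[OF that] x(1)])
  have RT_inj: "M *\<^sub>v x = 0\<^sub>v m" if M: "M \<in> S" "transpose_mat R *\<^sub>v (M *\<^sub>v x) = 0\<^sub>v k" for M
  proof -
    have C: "M *\<^sub>v x \<in> carrier_vec m" using SC[OF M(1)] x by simp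
    from multiple_y[OF C M(2) x_range[OF M(1)]] obtain \<mu> where eq: "M *\<^sub>v x = \<mu> \<cdot>\<^sub>v y" by blast
    show ?thesis using y_range[OF M(1) eq] eq y by auto
  qed
  \<comment> \<open>Multiplication by the transpose of \<open>R\<close> is injective on S x, so the
    independent vectors can be moved into dimension \<open>k = 2 * n\<close>, two less than
    \<open>m\<close>. This is the bound on the rank for which the field is assumed large
    enough.\<close>
  have "indep_family k \<rho> (\<lambda>i. transpose_mat R *\<^sub>v (N i *\<^sub>v x))"
    unfolding indep_family_def
  proof (intro allI impI)
    fix c i
    assume c: "\<forall>j<k. (\<Sum>i<\<rho>. c i * (transpose_mat R *\<^sub>v (N i *\<^sub>v x)) $ j) = 0" and i: "i < \<rho>"
    obtain M where M: "M \<in> S" "\<And>j. j < m \<Longrightarrow> (M *\<^sub>v x) $ j = (\<Sum>i<\<rho>. c i * (N i *\<^sub>v x) $ j)"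
      using mat_subspace_combination[OF S N, of \<rho> "\<lambda>i. i" c] x by blast
    have "(transpose_mat R *\<^sub>v (M *\<^sub>v x)) $ j = (\<Sum>i<\<rho>. c i * (transpose_mat R *\<^sub>v (N i *\<^sub>v x)) $ j)"
      if j: "j < k" for j
    proof -
      have "(transpose_mat R *\<^sub>v (M *\<^sub>v x)) $ j = (\<Sum>a<m. R $$ (a, j) * (\<Sum>i<\<rho>. c i * (N i *\<^sub>v x) $ a))"
        using RT_index[of "M *\<^sub>v x"] SC[OF M(1)] x(1) j M(2) by simp
      also have "\<dots> = (\<Sum>i<\<rho>. c i * (\<Sum>a<m. R $$ (a, j) * (N i *\<^sub>v x) $ a))"
        by (simp add: sum_distrib_left mult_ac) (rule sum.swap)
      also have "\<dots> = (\<Sum>i<\<rho>. c i * (transpose_mat R *\<^sub>v (N i *\<^sub>v x)) $ j)"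
        by (intro sum.cong refl arg_cong2[of _ _ _ _ "(*)"] RT_index[symmetric] j
          mult_mat_vec_carrier[OF SC[OF N] x(1)]) simp
      finally show ?thesis .
    qed
    then have "transpose_mat R *\<^sub>v (M *\<^sub>v x) = 0\<^sub>v k" using c R by (intro eq_vecI) auto
    from RT_inj[OF M(1) this] M(2) have "\<And>j. j < m \<Longrightarrow> (\<Sum>i<\<rho>. c i * (N i *\<^sub>v x) $ j) = 0" by simp
    then show "c i = 0" using i by (rule indep_familyD[OF indep])
  qed
  then have "\<rho> \<le> k" by (rule indep_family_le_dim)
  then have card: "infinite (UNIV :: 'a set) \<or> \<rho> < card (UNIV :: 'a set)"
    using Suc.prems(1) by (auto simp: k_def)
  have range: "\<exists>M'\<in>S. M *\<^sub>v z = M' *\<^sub>v x"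
    if M: "M \<in> S" "M *\<^sub>v x = 0\<^sub>v m" and z: "z \<in> carrier_vec m" for M z
  proof (rule maximal_rank_kernel_range[OF S N x(1) indep _ card M z])
    fix x' :: "'a vec" and N' :: "nat \<Rightarrow> 'a mat" assume x': "x' \<in> carrier_vec m" and N': "\<And>i. i < Suc \<rho> \<Longrightarrow> N' i \<in> S"
    show "\<not> indep_family m (Suc \<rho>) (\<lambda>i. N' i *\<^sub>v x')"
    proof
      assume indep': "indep_family m (Suc \<rho>) (\<lambda>i. N' i *\<^sub>v x')"
      \<comment> \<open>\<open>Q\<close> asks for a nonzero vector; at 0 all the values vanish, and
        a family with at least one member is then dependent.\<close>
      have "x' \<noteq> 0\<^sub>v m"
      proof
        assume "x' = 0\<^sub>v m"
        then have "(\<Sum>i<Suc \<rho>. 1 * (N' i *\<^sub>v x') $ j) = 0" if "j < m" for j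
        proof (intro sum.neutral ballI)
          fix i assume "i \<in> {..<Suc \<rho>}"
          then have "N' i \<in> carrier_mat m m" using SC[OF N'] by simp
          then show "1 * (N' i *\<^sub>v x') $ j = 0" using \<open>x' = 0\<^sub>v m\<close> that by auto
        qed
        then have "(1 :: 'a) = 0" by (rule indep_familyD[OF indep', of "\<lambda>_. 1"]) auto
        then show False by simp
      qed
      then have "Q (Suc \<rho>)" unfolding Q_def using x' N' indep' by blast
      then show False using \<rho>(2) by fastforce
    qed
  qed auto
  \<comment> \<open>By \<open>range\<close> the vector \<open>M *\<^sub>v z\<close> lies in S x,
    where by \<open>y_range\<close> the only multiple of \<open>y\<close> is zero.\<close>
  have no_y: "w = 0\<^sub>v m" if M: "M \<in> S" "M *\<^sub>v x = 0\<^sub>v m" and z: "z \<in> carrier_vec m"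
    and w: "w = M *\<^sub>v z" "\<exists>\<mu>. w = \<mu> \<cdot>\<^sub>v y" for M z w
  proof -
    obtain \<mu> where \<mu>: "w = \<mu> \<cdot>\<^sub>v y" using w by blast
    obtain M' where M': "M' \<in> S" "M *\<^sub>v z = M' *\<^sub>v x" using range[OF M z] by blast
    then show ?thesis using y_range[OF M'(1), of \<mu>] \<mu> w(1) y by (auto intro!: eq_vecI)
  qed
  \<comment> \<open>Composing with the transpose of \<open>R\<close> leaves the kernel of M |-> M x
    unchanged, by \<open>RT_inj\<close>, but lowers the dimension of the target from
    \<open>m\<close> to \<open>k\<close>, which bounds the loss by \<open>2 * n\<close>.\<close>
  define f where "f M = mat k 1 (\<lambda>(l, _). (transpose_mat R *\<^sub>v (M *\<^sub>v x)) $ l)" for M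
  interpret f: mat_linear m m k 1 S f
  proof
    show "f M \<in> carrier_mat k 1" for M by (simp add: f_def)
    show "f (A + B) = f A + f B" if "A \<in> S" "B \<in> S" for A B
      using SC[OF that(1)] SC[OF that(2)] R x
      by (auto simp: f_def add_mult_distrib_mat_vec[of _ m m] mult_add_distrib_mat_vec[OF RT] intro!: eq_matI)
    show "f (c \<cdot>\<^sub>m A) = c \<cdot>\<^sub>m f A" if "A \<in> S" for c A
    proof -
      have "(c \<cdot>\<^sub>m A) *\<^sub>v x = c \<cdot>\<^sub>v (A *\<^sub>v x)"
        using SC[OF that] x by (auto intro!: eq_vecI)
      then show ?thesis
        using SC[OF that] R x by (auto simp: f_def mult_mat_vec[OF RT] intro!: eq_matI)
    qed
  qed (rule S)
  define T where "T = {M \<in> S. f M = 0\<^sub>m k 1}"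
  have T: "mat_subspace m m T" unfolding T_def by (rule f.subspace_kernel)
  have TS: "M \<in> S" if "M \<in> T" for M using that by (simp add: T_def)
  have Tx: "M *\<^sub>v x = 0\<^sub>v m" if M: "M \<in> T" for M
  proof (rule RT_inj[OF TS[OF M]])
    have "(transpose_mat R *\<^sub>v (M *\<^sub>v x)) $ l = f M $$ (l, 0)" if "l < k" for l
      using that by (simp add: f_def)
    then show "transpose_mat R *\<^sub>v (M *\<^sub>v x) = 0\<^sub>v k"
      using M R by (intro eq_vecI) (auto simp: T_def)
  qed
  define g where "g M = transpose_mat R * M * R" for M
  have g_vec: "g M *\<^sub>v c = transpose_mat R *\<^sub>v (M *\<^sub>v (R *\<^sub>v c))"
    if "M \<in> carrier_mat m m" "c \<in> carrier_vec k" for M c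
    using that R RT unfolding g_def
    by (simp add: assoc_mult_mat_vec[of _ k m _ k] assoc_mult_mat_vec[of _ k m _ m])
  have g_add: "g (A + B) = g A + g B" if "A \<in> carrier_mat m m" "B \<in> carrier_mat m m" for A B
    using that R RT unfolding g_def
    by (simp add: mult_add_distrib_mat[of _ k m _ m] add_mult_distrib_mat[of _ k m _ _ k])
  interpret g: mat_linear m m k k T g
  proof
    fix A c assume A: "A \<in> T"
    note C = SC[OF TS[OF A]]
    show "g A \<in> carrier_mat k k" using C R by (simp add: g_def)
    show "g (c \<cdot>\<^sub>m A) = c \<cdot>\<^sub>m g A"
      using C R RT unfolding g_def
      by (simp add: mult_smult_distrib[of _ k m _ m] mult_smult_assoc_mat[of _ k m _ k])
  qed (auto simp: T intro!: g_add SC TS)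
  have dim_g: "mat_dim k k (g ` T) = mat_dim m m T"
  proof (rule g.dim_image_inj)
    fix M assume M: "M \<in> T" and gM: "g M = 0\<^sub>m k k"
    note MA = SA[OF TS[OF M]] and MC = SC[OF TS[OF M]]
    have x_orth: "x \<bullet> (M *\<^sub>v v) = 0" if "v \<in> carrier_vec m" for v
      using alternating_mats_form_swap[OF MA x(1) that] Tx[OF M] that by simp
    \<comment> \<open>\<open>no_y\<close> is needed twice. Here it shows that \<open>M\<close> kills
      the hyperplane; antisymmetry then makes the whole range of \<open>M\<close> orthogonal to the
      hyperplane, so a multiple of \<open>y\<close> again, and \<open>no_y\<close> kills it
      too.\<close>
    have hyp0: "M *\<^sub>v h = 0\<^sub>v m" if h: "h \<in> carrier_vec m" "y \<bullet> h = 0" for h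
    proof -
      obtain c \<mu> where c: "c \<in> carrier_vec k" and heq: "h = R *\<^sub>v c + \<mu> \<cdot>\<^sub>v x"
        using hyp[OF h] by blast
      have MRc: "M *\<^sub>v (R *\<^sub>v c) \<in> carrier_vec m" using MC Rc by simp
      have "transpose_mat R *\<^sub>v (M *\<^sub>v (R *\<^sub>v c)) = 0\<^sub>v k"
        using g_vec[OF MC c] gM zero_mult[OF c, of k] by simp
      then have "M *\<^sub>v (R *\<^sub>v c) = 0\<^sub>v m"
        by (intro no_y[OF TS[OF M] Tx[OF M] Rc refl] multiple_y MRc x_orth Rc)
      then show ?thesis
        using MC Rc[of c] x Tx[OF M]
        by (auto simp: heq mult_add_distrib_mat_vec[of _ m m] mult_mat_vec[of _ m m] intro!: eq_vecI)
    qed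
    show "M = 0\<^sub>m m m"
    proof (rule mat_eq_zeroI[OF MC])
      fix v :: "'a vec" assume v: "v \<in> carrier_vec m"
      have "\<exists>\<mu>. M *\<^sub>v v = \<mu> \<cdot>\<^sub>v y"
      proof (rule orthogonal_to_hyperplane[OF y y0])
        fix h assume h: "h \<in> carrier_vec m" "y \<bullet> h = 0"
        show "h \<bullet> (M *\<^sub>v v) = 0"
          using alternating_mats_form_swap[OF MA h(1) v] hyp0[OF h] v by simp
      qed (use MC v in simp)
      then show "M *\<^sub>v v = 0\<^sub>v m" by (rule no_y[OF TS[OF M] Tx[OF M] v refl])
    qed
  qed
  have "mat_dim k k (g ` T) \<le> n * (n - 1)"
  proof (rule Suc.IH[folded k_def])
    show "infinite (UNIV :: 'a set) \<or> k < card (UNIV :: 'a set) + 2"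
      using Suc.prems(1) by (auto simp: k_def)
    show "mat_subspace k k (g ` T)" by (rule g.subspace_image)
    show "g ` T \<subseteq> alternating_mats k" "g P \<in> alternating_mats k"
      using R P SA TS by (auto simp: g_def intro!: alternating_mats_congruence)
    fix L assume "L \<in> g ` T"
    then obtain M where M: "M \<in> T" "L = g M" by blast
    have MC: "P + M \<in> carrier_mat m m" using PC SC[OF TS[OF M(1)]] by simp
    have PM: "(P + M) *\<^sub>v x = y"
      using PC SC[OF TS[OF M(1)]] x Tx[OF M(1)] y
      by (simp add: add_mult_distrib_mat_vec[of _ m m] y_def)
    have alt: "P + M \<in> alternating_mats m"
      using P SA[OF TS[OF M(1)]] by (rule mat_subspaceD(4)[OF mat_subspace_alternating])
    have "g P + L = g (P + M)" using M g_add[OF PC SC[OF TS[OF M(1)]]] by simp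
    moreover have "invertible_mat (g (P + M))"
      unfolding invertible_mat_iff_trivial_kernel[of "g (P + M)" k, OF mult_carrier_mat[OF mult_carrier_mat[OF RT MC] R, folded g_def]]
    proof (intro ballI impI)
      fix c assume c: "c \<in> carrier_vec k" and "g (P + M) *\<^sub>v c = 0\<^sub>v k"
      then have 0: "transpose_mat R *\<^sub>v ((P + M) *\<^sub>v (R *\<^sub>v c)) = 0\<^sub>v k"
        using g_vec[OF MC c] by simp
      \<comment> \<open>Nondegeneracy of the reduced form: the image of R c is orthogonal to
        \<open>x\<close> and to the columns of \<open>R\<close>, hence a multiple \<mu> of
        \<open>y\<close>, which is itself (P + M) x. So R c - \<mu> x lies in the kernel of P + M,
        and R c is a multiple of \<open>x\<close>.\<close>
      have "x \<bullet> ((P + M) *\<^sub>v (R *\<^sub>v c)) = - ((R *\<^sub>v c) \<bullet> y)"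
        using alternating_mats_form_swap[OF alt x(1) Rc[of c]] PM by simp
      also have "\<dots> = 0" using yR[OF c] comm_scalar_prod[OF y Rc[of c]] by simp
      finally obtain \<mu> where \<mu>: "(P + M) *\<^sub>v (R *\<^sub>v c) = \<mu> \<cdot>\<^sub>v y"
        using multiple_y[OF _ 0] MC Rc[of c] by auto
      have "(P + M) *\<^sub>v (R *\<^sub>v c - \<mu> \<cdot>\<^sub>v x) = (P + M) *\<^sub>v (R *\<^sub>v c) - \<mu> \<cdot>\<^sub>v y"
        using MC Rc[of c] x PM
        by (simp add: mult_minus_distrib_mat_vec[of _ m m] mult_mat_vec[of _ m m])
      also have "\<dots> = 0\<^sub>v m" using \<mu> y by simp
      finally have z: "R *\<^sub>v c - \<mu> \<cdot>\<^sub>v x = 0\<^sub>v m"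
        using inj[OF TS[OF M(1)]] Rc[of c] x by auto
      have "R *\<^sub>v c = \<mu> \<cdot>\<^sub>v x"
      proof (rule eq_vecI)
        fix i assume "i < dim_vec (\<mu> \<cdot>\<^sub>v x)"
        then have i: "i < m" using x by simp
        then have "(R *\<^sub>v c - \<mu> \<cdot>\<^sub>v x) $ i = 0" using z by simp
        then show "(R *\<^sub>v c) $ i = (\<mu> \<cdot>\<^sub>v x) $ i" using i x by simp
      qed (use R x in simp)
      then show "c = 0\<^sub>v k" by (rule R_inj[OF c])
    qed
    ultimately show "invertible_mat (g P + L)" by simp
  qed
  moreover have "mat_dim k 1 (f ` S) \<le> mat_dim k 1 (carrier_mat k 1 :: 'a mat set)"
    by (rule mat_dim_mono[OF f.subspace_image mat_subspace_carrier]) (use f.carrier in auto)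
  ultimately have "mat_dim m m S \<le> 2 * n + n * (n - 1)"
    using f.rank_nullity dim_g by (simp add: mat_dim_carrier k_def T_def)
  also have "\<dots> = Suc n * (Suc n - 1)" by (cases n) auto
  finally show ?case by (simp add: m_def)
qed

lemma invertible_mat_iff_det: "(A :: 'a::field mat) \<in> carrier_mat n n \<Longrightarrow> invertible_mat A \<longleftrightarrow> det A \<noteq> 0"
  using invertible_mat_iff_trivial_kernel[of A n] det_0_iff_vec_prod_zero_field[of A n] by blast

subsection \<open>Affine spaces of invertible matrices\<close>

text \<open>Replacing the carrier by \<open>C\<close> covers both ambient spaces: alternating
  matrices directly, and all matrices through \<open>mat_space_carrier\<close>.\<close>

lemma affine_space_of_invertibles_iff:
  assumes C: "mat_subspace n n (C :: 'a::field mat set)"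
  shows "affine_space_of_invertibles ((mat_space n)\<lparr>carrier := C\<rparr>) X \<longleftrightarrow>
    (\<exists>p\<in>C. \<exists>S. mat_subspace n n S \<and> S \<subseteq> C \<and> X = (+) p ` S \<and> (\<forall>N\<in>S. invertible_mat (p + N)))"
  unfolding affine_space_of_invertibles_def affine_subspace_def subspace_mat_subspace_iff[OF C]
  by (auto simp: module_mat_simps)

lemma affine_dim_translate:
  assumes C: "mat_subspace n n (C :: 'a::field mat set)" and p: "p \<in> C"
    and S: "mat_subspace n n S" "S \<subseteq> C"
  shows "affine_dim ((mat_space n)\<lparr>carrier := C\<rparr>) ((+) p ` S) = mat_dim n n S"
proof -
  let ?V = "(mat_space n)\<lparr>carrier := C\<rparr>"
  have "subspace class_ring S ?V" using S by (simp add: subspace_mat_subspace_iff[OF C])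
  then have "direction ?V ((\<lambda>v. p \<oplus>\<^bsub>?V\<^esub> v) ` S) = S" by (rule direction_translate) (simp add: p)
  then show ?thesis by (simp add: affine_dim_def mat_dim_def module_mat_simps)
qed

section \<open>Unipotent upper triangular matrices\<close>

definition upper_pairs :: "nat \<Rightarrow> (nat \<times> nat) set" where
  "upper_pairs r = {(i, j). i < j \<and> j < r}"

lemma finite_upper_pairs: "finite (upper_pairs r)" and upper_pairs_subset: "upper_pairs r \<subseteq> {..<r} \<times> {..<r}"
proof -
  show "upper_pairs r \<subseteq> {..<r} \<times> {..<r}" by (auto simp: upper_pairs_def)
  then show "finite (upper_pairs r)" by (rule finite_subset) simp
qed

text \<open>Doubled to avoid a division; the bullet product also collects this number twice, from
  its first factor and from the block \<open>D\<close>.\<close>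

lemma card_upper_pairs: "2 * card (upper_pairs r) = r * (r - 1)"
proof (induction r)
  case 0
  then show ?case by (simp add: upper_pairs_def)
next
  case (Suc r)
  have "upper_pairs (Suc r) = upper_pairs r \<union> {..<r} \<times> {r}"
    by (auto simp: upper_pairs_def less_Suc_eq)
  moreover have "upper_pairs r \<inter> {..<r} \<times> {r} = {}" by (auto simp: upper_pairs_def)
  ultimately have "card (upper_pairs (Suc r)) = card (upper_pairs r) + r"
    by (simp add: card_Un_disjoint finite_upper_pairs card_cartesian_product)
  then show ?case using Suc by (cases r) (simp_all add: algebra_simps)
qed

definition strict_upper_mats :: "nat \<Rightarrow> 'a::field mat set" where
  "strict_upper_mats r = supported_mats r r (upper_pairs r)"

lemma mat_subspace_strict_upper: "mat_subspace r r (strict_upper_mats r)"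
  unfolding strict_upper_mats_def by (rule mat_subspace_supported)

lemma mat_dim_strict_upper: "mat_dim r r (strict_upper_mats r) = card (upper_pairs r)"
  unfolding strict_upper_mats_def by (rule mat_dim_supported[OF finite_upper_pairs upper_pairs_subset])

lemma strict_upper_matsD:
  assumes "N \<in> strict_upper_mats r"
  shows "N \<in> carrier_mat r r" "\<And>i j. i < r \<Longrightarrow> j \<le> i \<Longrightarrow> N $$ (i, j) = 0"
  using assms by (auto simp: strict_upper_mats_def supported_mats_def upper_pairs_def)

lemma invertible_unipotent:
  assumes N: "N \<in> strict_upper_mats r"
  shows "invertible_mat (1\<^sub>m r + N)"
proof -
  have C: "1\<^sub>m r + N \<in> carrier_mat r r" using strict_upper_matsD(1)[OF N] by simp
  have "upper_triangular (1\<^sub>m r + N)"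
    using strict_upper_matsD[OF N] by (intro upper_triangularI) auto
  then have "det (1\<^sub>m r + N) = prod_list (diag_mat (1\<^sub>m r + N))"
    by (rule det_upper_triangular[OF _ C])
  also have "diag_mat (1\<^sub>m r + N) = replicate r 1"
    using strict_upper_matsD[OF N] by (intro nth_equalityI) (auto simp: diag_mat_def)
  finally show ?thesis using invertible_mat_iff_det[OF C] by (simp add: prod_list_replicate)
qed

text \<open>A strictly upper triangular U and its transpose have disjoint supports, so U can be
  recovered from U - U^T, in characteristic two as well.\<close>

lemma mat_dim_alternating_ge: "card (upper_pairs r) \<le> mat_dim r r (alternating_mats r :: 'a::field mat set)"
proof -
  interpret mat_linear r r r r "strict_upper_mats r" "\<lambda>U :: 'a mat. U - transpose_mat U"
    by standard
      (auto simp: mat_subspace_strict_upper algebra_simps dest!: strict_upper_matsD(1) intro!: eq_matI)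
  have "mat_dim r r ((\<lambda>U :: 'a mat. U - transpose_mat U) ` strict_upper_mats r) = card (upper_pairs r)"
    unfolding mat_dim_strict_upper[where 'a='a, symmetric]
  proof (rule dim_image_inj)
    fix U :: "'a mat" assume U: "U \<in> strict_upper_mats r" and 0: "U - transpose_mat U = 0\<^sub>m r r"
    show "U = 0\<^sub>m r r"
    proof (rule eq_matI)
      fix i j assume "i < dim_row (0\<^sub>m r r :: 'a mat)" "j < dim_col (0\<^sub>m r r :: 'a mat)"
      then have ij: "i < r" "j < r" by auto
      have "(U - transpose_mat U) $$ (i, j) = 0" using 0 ij by simp
      then show "U $$ (i, j) = 0\<^sub>m r r $$ (i, j)"
        using ij strict_upper_matsD[OF U] by (cases "i < j") auto
    qed (use strict_upper_matsD(1)[OF U] in auto)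
  qed
  moreover have "mat_dim r r ((\<lambda>U :: 'a mat. U - transpose_mat U) ` strict_upper_mats r)
      \<le> mat_dim r r (alternating_mats r :: 'a mat set)"
  proof (rule mat_dim_mono[OF subspace_image mat_subspace_alternating])
    show "(\<lambda>U :: 'a mat. U - transpose_mat U) ` strict_upper_mats r \<subseteq> alternating_mats r"
      using strict_upper_matsD(1) by (fastforce simp: alternating_mats_iff)
  qed
  ultimately show ?thesis by simp
qed

subsection \<open>The bullet product\<close>

lemma bullet_mat_index:
  assumes "M \<in> carrier_mat r r" "C \<in> carrier_mat (2 * s) (2 * s)" "B \<in> carrier_mat (2 * s) r" "D \<in> carrier_mat r r"
    and "i < 2 * (r + s)" "j < 2 * (r + s)"
  shows "bullet_mat r s M C B D $$ (i, j) =
    (if i < r then if j < r + 2 * s then 0 else M $$ (i, j - (r + 2 * s))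
     else if i < r + 2 * s then
       if j < r then 0 else if j < r + 2 * s then C $$ (i - r, j - r) else B $$ (i - r, j - (r + 2 * s))
     else if j < r then - M $$ (j, i - (r + 2 * s))
     else if j < r + 2 * s then - B $$ (j - r, i - (r + 2 * s))
     else D $$ (i - (r + 2 * s), j - (r + 2 * s)))"
  using assms by (auto simp: bullet_mat_def append_rows_def)

lemma bullet_mat_carrier:
  assumes "C \<in> carrier_mat (2 * s) (2 * s)" "D \<in> carrier_mat r r"
  shows "bullet_mat r s M C B D \<in> carrier_mat (2 * (r + s)) (2 * (r + s))"
  using assms by (auto simp: bullet_mat_def)

lemma bullet_mat_alternating:
  assumes M: "M \<in> carrier_mat r r" and C: "C \<in> alternating_mats (2 * s)"
    and B: "B \<in> carrier_mat (2 * s) r" and D: "D \<in> alternating_mats r"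
  shows "bullet_mat r s M C B D \<in> alternating_mats (2 * (r + s))"
proof -
  note CC = alternating_matsD(1)[OF C] and DC = alternating_matsD(1)[OF D]
  note idx = bullet_mat_index[OF M CC B DC]
  show ?thesis unfolding alternating_mats_iff
  proof (intro conjI allI impI)
    show "bullet_mat r s M C B D \<in> carrier_mat (2 * (r + s)) (2 * (r + s))"
      by (rule bullet_mat_carrier[OF CC DC])
    fix i assume i: "i < 2 * (r + s)"
    then show "bullet_mat r s M C B D $$ (i, i) = 0"
      unfolding idx[OF i i] by (auto simp: alternating_matsD(3)[OF C] alternating_matsD(3)[OF D])
    fix j assume j: "j < 2 * (r + s)"
    show "bullet_mat r s M C B D $$ (j, i) = - bullet_mat r s M C B D $$ (i, j)"
      unfolding idx[OF i j] idx[OF j i]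
      using i j alternating_matsD(4)[OF C, of "i - r" "j - r"]
        alternating_matsD(4)[OF D, of "i - (r + 2 * s)" "j - (r + 2 * s)"] by auto
  qed
qed

lemma bullet_mat_add:
  assumes M: "M \<in> carrier_mat r r" "M' \<in> carrier_mat r r"
    and C: "C \<in> carrier_mat (2 * s) (2 * s)" "C' \<in> carrier_mat (2 * s) (2 * s)"
    and B: "B \<in> carrier_mat (2 * s) r" "B' \<in> carrier_mat (2 * s) r"
    and D: "D \<in> carrier_mat r r" "D' \<in> carrier_mat r r"
  shows "bullet_mat r s (M + M') (C + C') (B + B') (D + D') = bullet_mat r s M C B D + bullet_mat r s M' C' B' D'"
proof (rule eq_matI)
  note sums = add_carrier_mat[OF M(2), of M] add_carrier_mat[OF C(2), of C]
    add_carrier_mat[OF B(2), of B] add_carrier_mat[OF D(2), of D]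
  note c = bullet_mat_carrier[OF C(1) D(1), of M B] bullet_mat_carrier[OF C(2) D(2), of M' B']
    bullet_mat_carrier[OF sums(2,4), of "M + M'" "B + B'"]
  fix i j assume "i < dim_row (bullet_mat r s M C B D + bullet_mat r s M' C' B' D')"
    "j < dim_col (bullet_mat r s M C B D + bullet_mat r s M' C' B' D')"
  then have ij: "i < 2 * (r + s)" "j < 2 * (r + s)" using c by auto
  show "bullet_mat r s (M + M') (C + C') (B + B') (D + D') $$ (i, j) =
      (bullet_mat r s M C B D + bullet_mat r s M' C' B' D') $$ (i, j)"
    unfolding index_add_mat(1)[of i "bullet_mat r s M' C' B' D'" j, unfolded carrier_matD[OF c(2)], OF ij]
      bullet_mat_index[OF M(1) C(1) B(1) D(1) ij] bullet_mat_index[OF M(2) C(2) B(2) D(2) ij]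
      bullet_mat_index[OF sums ij]
    using assms ij by auto
qed (use bullet_mat_carrier[OF C(2) D(2), of M' B'] bullet_mat_carrier[of "C + C'" s "D + D'" r] C D in auto)

lemma bullet_mat_smult:
  assumes M: "M \<in> carrier_mat r r" and C: "C \<in> carrier_mat (2 * s) (2 * s)"
    and B: "B \<in> carrier_mat (2 * s) r" and D: "D \<in> carrier_mat r r"
  shows "bullet_mat r s (c \<cdot>\<^sub>m M) (c \<cdot>\<^sub>m C) (c \<cdot>\<^sub>m B) (c \<cdot>\<^sub>m D) = c \<cdot>\<^sub>m bullet_mat r s M C B D"
proof (rule eq_matI)
  note sm = smult_carrier_mat[OF M, of c] smult_carrier_mat[OF C, of c]
    smult_carrier_mat[OF B, of c] smult_carrier_mat[OF D, of c]
  note bc = bullet_mat_carrier[OF C D, of M B]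
  fix i j assume "i < dim_row (c \<cdot>\<^sub>m bullet_mat r s M C B D)" "j < dim_col (c \<cdot>\<^sub>m bullet_mat r s M C B D)"
  then have ij: "i < 2 * (r + s)" "j < 2 * (r + s)" using bc by auto
  show "bullet_mat r s (c \<cdot>\<^sub>m M) (c \<cdot>\<^sub>m C) (c \<cdot>\<^sub>m B) (c \<cdot>\<^sub>m D) $$ (i, j) =
      (c \<cdot>\<^sub>m bullet_mat r s M C B D) $$ (i, j)"
    unfolding index_smult_mat(1)[of i "bullet_mat r s M C B D" j, unfolded carrier_matD[OF bc], OF ij]
      bullet_mat_index[OF M C B D ij] bullet_mat_index[OF sm ij]
    using assms ij by auto
qed (use bullet_mat_carrier[OF C D, of M B] bullet_mat_carrier[of "c \<cdot>\<^sub>m C" s "c \<cdot>\<^sub>m D" r] C D in auto)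

lemma bullet_mat_zero: "bullet_mat r s (0\<^sub>m r r) (0\<^sub>m (2 * s) (2 * s)) (0\<^sub>m (2 * s) r) (0\<^sub>m r r) = 0\<^sub>m (2 * (r + s)) (2 * (r + s))"
  by (rule eq_matI) (auto simp: bullet_mat_def append_rows_def)

text \<open>Back substitution for v = (v1, v2, v3): the first block row gives M v3 = 0, the second
  then C v2 = 0, and the third is left with M^T v1 = 0.\<close>

lemma bullet_mat_invertible:
  assumes M: "M \<in> carrier_mat r r" "invertible_mat M"
    and C: "C \<in> carrier_mat (2 * s) (2 * s)" "invertible_mat C"
    and B: "B \<in> carrier_mat (2 * s) r" and D: "D \<in> carrier_mat r r"
  shows "invertible_mat (bullet_mat r s (M :: 'a::field mat) C B D)"
  unfolding invertible_mat_iff_trivial_kernel[OF bullet_mat_carrier[OF C(1) D]]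
proof (intro ballI impI)
  fix v :: "'a vec" assume v: "v \<in> carrier_vec (2 * (r + s))"
    and kernel: "bullet_mat r s M C B D *\<^sub>v v = 0\<^sub>v (2 * (r + s))"
  have ker: "w = 0\<^sub>v n" if "A \<in> carrier_mat n n" "invertible_mat A" "w \<in> carrier_vec n" "A *\<^sub>v w = 0\<^sub>v n"
    for A :: "'a mat" and w n
    using that invertible_mat_iff_trivial_kernel by blast
  define a where "a = vec_first v (r + 2 * s)"
  define v3 where "v3 = vec_last v r"
  define v1 where "v1 = vec_first a r"
  define v2 where "v2 = vec_last a (2 * s)"
  have v_eq: "v = a @\<^sub>v v3" unfolding a_def v3_def
    by (rule vec_first_last_append[symmetric]) (use v in \<open>simp add: algebra_simps\<close>)
  have a: "a \<in> carrier_vec (r + 2 * s)" by (simp add: a_def)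
  have a_eq: "a = v1 @\<^sub>v v2" unfolding v1_def v2_def
    by (rule vec_first_last_append[symmetric, OF a])
  have c: "v1 \<in> carrier_vec r" "v2 \<in> carrier_vec (2 * s)" "v3 \<in> carrier_vec r"
    by (simp_all add: v1_def v2_def v3_def)
  let ?MB = "M @\<^sub>r B"
  let ?Z = "four_block_mat (0\<^sub>m r r) (0\<^sub>m r (2 * s)) (0\<^sub>m (2 * s) r) C"
  have MB: "?MB \<in> carrier_mat (r + 2 * s) r" using M B by auto
  have Z: "?Z \<in> carrier_mat (r + 2 * s) (r + 2 * s)" using C by auto
  have zero_mult: "0\<^sub>m i j *\<^sub>v w = 0\<^sub>v i" if "w \<in> carrier_vec j" for i j and w :: "'a vec"
    using that by (auto intro!: eq_vecI)
  have zero_split: "0\<^sub>v (i + j) = (0\<^sub>v i @\<^sub>v 0\<^sub>v j :: 'a vec)" for i j by (auto intro!: eq_vecI)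
  have "bullet_mat r s M C B D *\<^sub>v v = (?Z *\<^sub>v a + ?MB *\<^sub>v v3) @\<^sub>v (- transpose_mat ?MB *\<^sub>v a + D *\<^sub>v v3)"
    unfolding bullet_mat_def v_eq
    by (rule four_block_mat_mult_vec[OF Z MB _ D a c(3)]) (use MB in simp)
  moreover have "0\<^sub>v (2 * (r + s)) = (0\<^sub>v (r + 2 * s) @\<^sub>v 0\<^sub>v r :: 'a vec)"
    by (auto simp flip: zero_split simp: algebra_simps)
  ultimately have top: "?Z *\<^sub>v a + ?MB *\<^sub>v v3 = 0\<^sub>v (r + 2 * s)"
    and bot: "- transpose_mat ?MB *\<^sub>v a + D *\<^sub>v v3 = 0\<^sub>v r"
    using kernel Z MB a c D append_vec_eq[of "?Z *\<^sub>v a + ?MB *\<^sub>v v3" "r + 2 * s" "0\<^sub>v (r + 2 * s)"] by auto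
  have "?Z *\<^sub>v a = 0\<^sub>v r @\<^sub>v (C *\<^sub>v v2)" unfolding a_eq
    by (subst four_block_mat_mult_vec[OF zero_carrier_mat zero_carrier_mat zero_carrier_mat C(1) c(1,2)])
      (use c C in \<open>auto simp: zero_mult\<close>)
  moreover have "?MB *\<^sub>v v3 = (M *\<^sub>v v3) @\<^sub>v (B *\<^sub>v v3)" by (rule mat_mult_append[OF M(1) B c(3)])
  ultimately have "?Z *\<^sub>v a + ?MB *\<^sub>v v3 = (M *\<^sub>v v3) @\<^sub>v (C *\<^sub>v v2 + B *\<^sub>v v3)"
    using append_vec_add[of "0\<^sub>v r" r "M *\<^sub>v v3" "C *\<^sub>v v2" "2 * s" "B *\<^sub>v v3"] M C B c by simp
  then have "(M *\<^sub>v v3) @\<^sub>v (C *\<^sub>v v2 + B *\<^sub>v v3) = 0\<^sub>v r @\<^sub>v 0\<^sub>v (2 * s)"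
    using top by (simp only: zero_split)
  then have "M *\<^sub>v v3 = 0\<^sub>v r" and eq2: "C *\<^sub>v v2 + B *\<^sub>v v3 = 0\<^sub>v (2 * s)"
    by (simp_all only: append_vec_eq[OF mult_mat_vec_carrier[OF M(1) c(3)] zero_carrier_vec])
  then have v3: "v3 = 0\<^sub>v r" using ker[OF M c(3)] by simp
  have "B *\<^sub>v v3 = 0\<^sub>v (2 * s)" using B by (auto simp: v3 intro!: eq_vecI)
  then have v2: "v2 = 0\<^sub>v (2 * s)" using ker[OF C c(2)] eq2 C c by simp
  have tr: "transpose_mat ?MB *\<^sub>v a = 0\<^sub>v r"
  proof (rule eq_vecI)
    fix i assume "i < dim_vec (0\<^sub>v r :: 'a vec)"
    then have i: "i < r" by simp
    have "(- transpose_mat ?MB *\<^sub>v a + D *\<^sub>v v3) $ i = - ((transpose_mat ?MB *\<^sub>v a) $ i) + (D *\<^sub>v v3) $ i"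
      using MB D i a by (simp add: uminus_mult_mat_vec)
    moreover have "(- transpose_mat ?MB *\<^sub>v a + D *\<^sub>v v3) $ i = 0"
      unfolding bot using i by simp
    moreover have "(D *\<^sub>v v3) $ i = 0" using i D by (simp add: v3)
    ultimately show "(transpose_mat ?MB *\<^sub>v a) $ i = 0\<^sub>v r $ i" using i by simp
  qed (use MB in simp)
  have MT: "transpose_mat M \<in> carrier_mat r r" using M by simp
  have "transpose_mat M *\<^sub>v v1 = 0\<^sub>v r"
  proof (rule eq_vecI)
    fix i assume "i < dim_vec (0\<^sub>v r :: 'a vec)"
    then have i: "i < r" by simp
    \<comment> \<open>Pairing with unit vectors moves the transpose to the other side, where the
      stacked matrix splits into its blocks; the part with \<open>B\<close> is paired with
      \<open>v2 = 0\<close>.\<close>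
    have "(transpose_mat ?MB *\<^sub>v a) \<bullet> unit_vec r i = a \<bullet> (?MB *\<^sub>v unit_vec r i)"
      by (rule transpose_vec_mult_scalar[OF MB _ a]) simp
    also have "?MB *\<^sub>v unit_vec r i = (M *\<^sub>v unit_vec r i) @\<^sub>v (B *\<^sub>v unit_vec r i)"
      by (rule mat_mult_append[OF M(1) B]) simp
    also have "a \<bullet> \<dots> = v1 \<bullet> (M *\<^sub>v unit_vec r i) + v2 \<bullet> (B *\<^sub>v unit_vec r i)"
      unfolding a_eq by (rule scalar_prod_append[of _ r _ "2 * s"]) (use M B c in auto)
    also have "\<dots> = (transpose_mat M *\<^sub>v v1) \<bullet> unit_vec r i"
      using transpose_vec_mult_scalar[OF M(1) _ c(1), of "unit_vec r i"] B i by (simp add: v2)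
    finally show "(transpose_mat M *\<^sub>v v1) $ i = 0\<^sub>v r $ i"
      using MT i by (simp add: tr del: index_mult_mat_vec)
  qed (use M in simp)
  moreover have "invertible_mat (transpose_mat M)"
    using M by (simp add: invertible_mat_iff_det[OF MT] invertible_mat_iff_det[OF M(1)] det_transpose)
  ultimately have "v1 = 0\<^sub>v r" using ker[OF MT _ c(1)] by blast
  then show "v = 0\<^sub>v (2 * (r + s))"
    by (auto simp: v_eq a_eq v2 v3 intro!: eq_vecI)
qed

lemma bullet_subset_alternating:
  assumes "\<W> \<subseteq> carrier_mat r r" "\<C> \<subseteq> alternating_mats (2 * s)"
  shows "bullet r s \<W> \<C> \<subseteq> alternating_mats (2 * (r + s))"
  using assms unfolding bullet_def by (blast intro: bullet_mat_alternating)

lemma bulletI: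
  assumes "M \<in> \<W>" "C \<in> \<C>" "B \<in> carrier_mat (2 * s) r" "D \<in> alternating_mats r"
  shows "bullet_mat r s M C B D \<in> bullet r s \<W> \<C>"
  using assms unfolding bullet_def by blast

lemma bulletE:
  assumes "X \<in> bullet r s \<W> \<C>"
  obtains M C B D where "X = bullet_mat r s M C B D" "M \<in> \<W>" "C \<in> \<C>"
    "B \<in> carrier_mat (2 * s) r" "D \<in> alternating_mats r"
  using assms unfolding bullet_def by blast

lemma mat_subspace_bullet:
  assumes U: "mat_subspace r r (U :: 'a::field mat set)" and V: "mat_subspace (2 * s) (2 * s) V"
    and VA: "V \<subseteq> alternating_mats (2 * s)"
  shows "mat_subspace (2 * (r + s)) (2 * (r + s)) (bullet r s U V)"
  unfolding mat_subspace_def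
proof (intro conjI ballI allI)
  note UC = mat_subspaceD(3)[OF U] and VC = mat_subspaceD(3)[OF V]
  note AS = mat_subspace_alternating[of r, where 'a='a]
  note AC = mat_subspaceD(3)[OF AS]
  show "bullet r s U V \<subseteq> carrier_mat (2 * (r + s)) (2 * (r + s))"
    using bullet_subset_alternating[OF mat_subspaceD(1)[OF U] VA] alternating_matsD(1) by blast
  show "0\<^sub>m (2 * (r + s)) (2 * (r + s)) \<in> bullet r s U V"
    unfolding bullet_mat_zero[symmetric]
    by (intro bulletI mat_subspaceD(2)[OF U] mat_subspaceD(2)[OF V] mat_subspaceD(2)[OF AS] zero_carrier_mat)
  fix X assume "X \<in> bullet r s U V"
  then obtain M C B D where X: "X = bullet_mat r s M C B D" "M \<in> U" "C \<in> V"
    "B \<in> carrier_mat (2 * s) r" "D \<in> alternating_mats r" by (rule bulletE)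
  show "c \<cdot>\<^sub>m X \<in> bullet r s U V" for c
    unfolding X(1) bullet_mat_smult[OF UC[OF X(2)] VC[OF X(3)] X(4) AC[OF X(5)], symmetric]
    using X by (intro bulletI mat_subspaceD(5)[OF U] mat_subspaceD(5)[OF V] mat_subspaceD(5)[OF AS]) auto
  fix Y assume "Y \<in> bullet r s U V"
  then obtain M' C' B' D' where Y: "Y = bullet_mat r s M' C' B' D'" "M' \<in> U" "C' \<in> V"
    "B' \<in> carrier_mat (2 * s) r" "D' \<in> alternating_mats r" by (rule bulletE)
  show "X + Y \<in> bullet r s U V"
    unfolding X(1) Y(1) bullet_mat_add[OF UC[OF X(2)] UC[OF Y(2)] VC[OF X(3)] VC[OF Y(3)] X(4) Y(4)
        AC[OF X(5)] AC[OF Y(5)], symmetric]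
    using X Y by (intro bulletI mat_subspaceD(4)[OF U] mat_subspaceD(4)[OF V] mat_subspaceD(4)[OF AS]) auto
qed

definition block_at :: "nat \<Rightarrow> nat \<Rightarrow> nat \<Rightarrow> nat \<Rightarrow> 'a mat \<Rightarrow> 'a mat" where
  "block_at a b nr nc X = mat nr nc (\<lambda>(i, j). X $$ (a + i, b + j))"

lemma mat_linear_block_at:
  assumes "mat_subspace m n S" "a + nr \<le> m" "b + nc \<le> n"
  shows "mat_linear m n nr nc S (block_at a b nr nc)"
proof
  fix A B c assume A: "A \<in> S" and "B \<in> S"
  then have "A \<in> carrier_mat m n" "B \<in> carrier_mat m n" using mat_subspaceD(3)[OF assms(1)] by auto
  then show "block_at a b nr nc (A + B) = block_at a b nr nc A + block_at a b nr nc B"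
    "block_at a b nr nc (c \<cdot>\<^sub>m A) = c \<cdot>\<^sub>m block_at a b nr nc A"
    using assms(2,3) by (auto simp: block_at_def intro!: eq_matI)
qed (auto simp: assms(1) block_at_def)

text \<open>Reading off the blocks \<open>M\<close>, \<open>C\<close> and \<open>B\<close> one after the other, each time passing to the kernel,
  leaves the matrices whose only nonzero block is \<open>D\<close>.\<close>

lemma mat_dim_bullet_ge:
  assumes U: "mat_subspace r r (U :: 'a::field mat set)" and V: "mat_subspace (2 * s) (2 * s) V"
    and VA: "V \<subseteq> alternating_mats (2 * s)"
  shows "mat_dim r r U + mat_dim (2 * s) (2 * s) V + 2 * s * r + card (upper_pairs r)
    \<le> mat_dim (2 * (r + s)) (2 * (r + s)) (bullet r s U V)"
proof -
  define n where "n = 2 * (r + s)"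
  define X where "X = bullet r s U V"
  note UC = mat_subspaceD(3)[OF U] and VC = mat_subspaceD(3)[OF V] and AC = alternating_matsD(1)
  have X: "mat_subspace n n X" unfolding X_def n_def by (rule mat_subspace_bullet[OF U V VA])
  let ?fM = "block_at 0 (r + 2 * s) r r :: 'a mat \<Rightarrow> 'a mat"
  let ?fC = "block_at r r (2 * s) (2 * s) :: 'a mat \<Rightarrow> 'a mat"
  let ?fB = "block_at r (r + 2 * s) (2 * s) r :: 'a mat \<Rightarrow> 'a mat"
  have blocks: "?fM (bullet_mat r s M C B D) = M" "?fC (bullet_mat r s M C B D) = C"
      "?fB (bullet_mat r s M C B D) = B"
    if "M \<in> carrier_mat r r" "C \<in> carrier_mat (2 * s) (2 * s)" "B \<in> carrier_mat (2 * s) r" "D \<in> carrier_mat r r"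
    for M C B D :: "'a mat"
    using that by (auto simp: block_at_def bullet_mat_index intro!: eq_matI)
  define X1 where "X1 = {A \<in> X. ?fM A = 0\<^sub>m r r}"
  define X2 where "X2 = {A \<in> X1. ?fC A = 0\<^sub>m (2 * s) (2 * s)}"
  define X3 where "X3 = {A \<in> X2. ?fB A = 0\<^sub>m (2 * s) r}"
  interpret m: mat_linear n n r r X ?fM by (rule mat_linear_block_at[OF X]) (auto simp: n_def)
  have X1: "mat_subspace n n X1" unfolding X1_def by (rule m.subspace_kernel)
  interpret c: mat_linear n n "2 * s" "2 * s" X1 ?fC
    by (rule mat_linear_block_at[OF X1]) (auto simp: n_def)
  have X2: "mat_subspace n n X2" unfolding X2_def by (rule c.subspace_kernel)
  interpret b: mat_linear n n "2 * s" r X2 ?fB by (rule mat_linear_block_at[OF X2]) (auto simp: n_def)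
  have X3: "mat_subspace n n X3" unfolding X3_def by (rule b.subspace_kernel)
  have zeros: "0\<^sub>m r r \<in> U" "0\<^sub>m (2 * s) (2 * s) \<in> V" "0\<^sub>m r r \<in> (alternating_mats r :: 'a mat set)"
    using mat_subspaceD(2)[OF U] mat_subspaceD(2)[OF V] mat_subspaceD(2)[OF mat_subspace_alternating] by auto
  have inX: "bullet_mat r s M C B D \<in> X"
    if "M \<in> U" "C \<in> V" "B \<in> carrier_mat (2 * s) r" "D \<in> alternating_mats r" for M C B D
    unfolding X_def using that by (rule bulletI)
  have "?fM ` X = U"
  proof
    show "?fM ` X \<subseteq> U"
      unfolding X_def by (auto elim!: bulletE simp: blocks UC VC AC)
    show "U \<subseteq> ?fM ` X"
    proof
      fix M assume M: "M \<in> U"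
      then have "?fM (bullet_mat r s M (0\<^sub>m (2 * s) (2 * s)) (0\<^sub>m (2 * s) r) (0\<^sub>m r r)) = M"
        by (intro blocks UC zero_carrier_mat)
      then show "M \<in> ?fM ` X" using inX[OF M zeros(2) zero_carrier_mat zeros(3)] by (metis imageI)
    qed
  qed
  then have d1: "mat_dim n n X = mat_dim r r U + mat_dim n n X1"
    using m.rank_nullity by (simp add: X1_def)
  have inX1: "bullet_mat r s (0\<^sub>m r r) C B D \<in> X1"
    if "C \<in> V" "B \<in> carrier_mat (2 * s) r" "D \<in> alternating_mats r" for C B D
    unfolding X1_def using inX[OF zeros(1) that] blocks(1)[OF zero_carrier_mat VC[OF that(1)] that(2) AC[OF that(3)]]
    by simp
  have "?fC ` X1 = V"
  proof
    show "?fC ` X1 \<subseteq> V"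
      unfolding X1_def X_def by (auto elim!: bulletE simp: blocks UC VC AC)
    show "V \<subseteq> ?fC ` X1"
    proof
      fix C assume C: "C \<in> V"
      then have "?fC (bullet_mat r s (0\<^sub>m r r) C (0\<^sub>m (2 * s) r) (0\<^sub>m r r)) = C"
        by (intro blocks VC zero_carrier_mat)
      then show "C \<in> ?fC ` X1" using inX1[OF C zero_carrier_mat zeros(3)] by (metis imageI)
    qed
  qed
  then have d2: "mat_dim n n X1 = mat_dim (2 * s) (2 * s) V + mat_dim n n X2"
    using c.rank_nullity by (simp add: X2_def)
  have inX2: "bullet_mat r s (0\<^sub>m r r) (0\<^sub>m (2 * s) (2 * s)) B D \<in> X2"
    if "B \<in> carrier_mat (2 * s) r" "D \<in> alternating_mats r" for B D
    unfolding X2_def using inX1[OF zeros(2) that] blocks(2)[OF zero_carrier_mat zero_carrier_mat that(1) AC[OF that(2)]]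
    by simp
  have "?fB ` X2 = carrier_mat (2 * s) r"
  proof
    show "?fB ` X2 \<subseteq> carrier_mat (2 * s) r" using b.carrier by blast
    show "carrier_mat (2 * s) r \<subseteq> ?fB ` X2"
    proof
      fix B :: "'a mat" assume B: "B \<in> carrier_mat (2 * s) r"
      then have "?fB (bullet_mat r s (0\<^sub>m r r) (0\<^sub>m (2 * s) (2 * s)) B (0\<^sub>m r r)) = B"
        by (intro blocks zero_carrier_mat)
      then show "B \<in> ?fB ` X2" using inX2[OF B zeros(3)] by (metis imageI)
    qed
  qed
  then have d3: "mat_dim n n X2 = 2 * s * r + mat_dim n n X3"
    using b.rank_nullity by (simp add: X3_def mat_dim_carrier)
  define g :: "'a mat \<Rightarrow> 'a mat" where
    "g D = bullet_mat r s (0\<^sub>m r r) (0\<^sub>m (2 * s) (2 * s)) (0\<^sub>m (2 * s) r) D" for D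
  interpret g: mat_linear r r n n "alternating_mats r" g
  proof
    fix A B :: "'a mat" and c :: 'a
    assume A: "A \<in> alternating_mats r"
    show "g A \<in> carrier_mat n n" unfolding g_def n_def by (rule bullet_mat_carrier[OF zero_carrier_mat AC[OF A]])
    have "c \<cdot>\<^sub>m 0\<^sub>m i j = (0\<^sub>m i j :: 'a mat)" for i j by auto
    then show "g (c \<cdot>\<^sub>m A) = c \<cdot>\<^sub>m g A"
      unfolding g_def bullet_mat_smult[OF zero_carrier_mat zero_carrier_mat zero_carrier_mat AC[OF A], symmetric]
      by simp
    assume B: "B \<in> alternating_mats r"
    have "0\<^sub>m i j + 0\<^sub>m i j = (0\<^sub>m i j :: 'a mat)" for i j by auto
    then show "g (A + B) = g A + g B"
      unfolding g_def bullet_mat_add[OF zero_carrier_mat zero_carrier_mat zero_carrier_mat zero_carrier_mat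
          zero_carrier_mat zero_carrier_mat AC[OF A] AC[OF B], symmetric] by simp
  qed (rule mat_subspace_alternating)
  have "mat_dim n n (g ` alternating_mats r) = mat_dim r r (alternating_mats r :: 'a mat set)"
  proof (rule g.dim_image_inj)
    fix D :: "'a mat" assume D: "D \<in> alternating_mats r" and 0: "g D = 0\<^sub>m n n"
    show "D = 0\<^sub>m r r"
    proof (rule eq_matI)
      fix i j assume "i < dim_row (0\<^sub>m r r :: 'a mat)" "j < dim_col (0\<^sub>m r r :: 'a mat)"
      then have ij: "i < r" "j < r" by auto
      have "g D $$ (r + 2 * s + i, r + 2 * s + j) = D $$ (i, j)"
        using ij AC[OF D] by (simp add: g_def bullet_mat_index)
      moreover have "g D $$ (r + 2 * s + i, r + 2 * s + j) = 0" using ij by (simp add: 0 n_def)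
      ultimately show "D $$ (i, j) = 0\<^sub>m r r $$ (i, j)" using ij by simp
    qed (use AC[OF D] in auto)
  qed
  moreover have "mat_dim n n (g ` alternating_mats r) \<le> mat_dim n n X3"
  proof (rule mat_dim_mono[OF g.subspace_image X3], rule image_subsetI)
    fix D :: "'a mat" assume D: "D \<in> alternating_mats r"
    show "g D \<in> X3"
      unfolding X3_def g_def using inX2[OF zero_carrier_mat D]
        blocks(3)[OF zero_carrier_mat zero_carrier_mat zero_carrier_mat AC[OF D]] by simp
  qed
  ultimately have "card (upper_pairs r) \<le> mat_dim n n X3"
    using mat_dim_alternating_ge[of r, where 'a='a] by simp
  then show ?thesis using d1 d2 d3 unfolding X_def n_def by simp
qed

text \<open>The blocks \<open>B\<close> and \<open>D\<close> run through linear spaces, so the base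
  point may carry zeros there.\<close>

lemma bullet_translate:
  assumes p: "p \<in> carrier_mat r r" and q: "q \<in> carrier_mat (2 * s) (2 * s)"
    and U: "U \<subseteq> carrier_mat r r" and V: "V \<subseteq> carrier_mat (2 * s) (2 * s)"
  shows "bullet r s ((+) p ` U) ((+) q ` V) =
    (+) (bullet_mat r s p q (0\<^sub>m (2 * s) r) (0\<^sub>m r r)) ` bullet r s U V"
proof -
  have eq: "bullet_mat r s (p + M) (q + C) B D = bullet_mat r s p q (0\<^sub>m (2 * s) r) (0\<^sub>m r r) + bullet_mat r s M C B D"
    if "M \<in> U" "C \<in> V" "B \<in> carrier_mat (2 * s) r" "D \<in> alternating_mats r" for M C B D
    using bullet_mat_add[OF p subsetD[OF U that(1)] q subsetD[OF V that(2)] zero_carrier_mat that(3)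
        zero_carrier_mat alternating_matsD(1)[OF that(4)]] that(3) alternating_matsD(1)[OF that(4)] by simp
  show ?thesis
  proof (intro equalityI subsetI)
    fix X assume "X \<in> bullet r s ((+) p ` U) ((+) q ` V)"
    then obtain M C B D where "X = bullet_mat r s (p + M) (q + C) B D" "M \<in> U" "C \<in> V"
      "B \<in> carrier_mat (2 * s) r" "D \<in> alternating_mats r" by (auto elim: bulletE)
    then show "X \<in> (+) (bullet_mat r s p q (0\<^sub>m (2 * s) r) (0\<^sub>m r r)) ` bullet r s U V"
      by (auto simp: eq intro: bulletI)
  next
    fix X assume "X \<in> (+) (bullet_mat r s p q (0\<^sub>m (2 * s) r) (0\<^sub>m r r)) ` bullet r s U V"
    then obtain M C B D where "X = bullet_mat r s p q (0\<^sub>m (2 * s) r) (0\<^sub>m r r) + bullet_mat r s M C B D"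
      "M \<in> U" "C \<in> V" "B \<in> carrier_mat (2 * s) r" "D \<in> alternating_mats r" by (auto elim!: bulletE)
    then show "X \<in> bullet r s ((+) p ` U) ((+) q ` V)"
      by (auto simp flip: eq intro: bulletI)
  qed
qed

lemma bullet_affine_space_of_invertibles:
  fixes p q :: "'a::field mat"
  assumes p: "p \<in> carrier_mat r r" and U: "mat_subspace r r U" "\<And>N. N \<in> U \<Longrightarrow> invertible_mat (p + N)"
    and q: "q \<in> alternating_mats (2 * s)" and V: "mat_subspace (2 * s) (2 * s) V"
    and VA: "V \<subseteq> alternating_mats (2 * s)" and VI: "\<And>N. N \<in> V \<Longrightarrow> invertible_mat (q + N)"
  defines "X \<equiv> bullet r s ((+) p ` U) ((+) q ` V)"
  shows "affine_space_of_invertibles (alternating_space (2 * (r + s))) X"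
    and "mat_dim r r U + mat_dim (2 * s) (2 * s) V + 2 * s * r + card (upper_pairs r)
      \<le> affine_dim (alternating_space (2 * (r + s))) X"
proof -
  let ?P = "bullet_mat r s p q (0\<^sub>m (2 * s) r) (0\<^sub>m r r)"
  note qC = alternating_matsD(1)[OF q]
  have P: "?P \<in> alternating_mats (2 * (r + s))"
    using p q mat_subspaceD(2)[OF mat_subspace_alternating] by (intro bullet_mat_alternating) auto
  have X: "X = (+) ?P ` bullet r s U V"
    unfolding X_def by (rule bullet_translate[OF p qC mat_subspaceD(1)[OF U(1)] mat_subspaceD(1)[OF V]])
  have sub: "mat_subspace (2 * (r + s)) (2 * (r + s)) (bullet r s U V)"
    by (rule mat_subspace_bullet[OF U(1) V VA])
  have alt: "bullet r s U V \<subseteq> alternating_mats (2 * (r + s))"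
    by (rule bullet_subset_alternating[OF mat_subspaceD(1)[OF U(1)] VA])
  have "invertible_mat A" if "A \<in> X" for A
  proof -
    from that obtain M C B D where A: "A = bullet_mat r s (p + M) (q + C) B D" "M \<in> U" "C \<in> V"
      "B \<in> carrier_mat (2 * s) r" "D \<in> alternating_mats r" unfolding X_def by (auto elim: bulletE)
    show ?thesis unfolding A(1)
      by (rule bullet_mat_invertible[OF add_carrier_mat[OF mat_subspaceD(3)[OF U(1) A(2)]] U(2)[OF A(2)]
        add_carrier_mat[OF mat_subspaceD(3)[OF V A(3)]] VI[OF A(3)] A(4) alternating_matsD(1)[OF A(5)]])
  qed
  then have inv: "\<forall>N\<in>bullet r s U V. invertible_mat (?P + N)" by (simp add: X)
  show "affine_space_of_invertibles (alternating_space (2 * (r + s))) X"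
    unfolding affine_space_of_invertibles_iff[OF mat_subspace_alternating]
    using P X sub alt inv by blast
  show "mat_dim r r U + mat_dim (2 * s) (2 * s) V + 2 * s * r + card (upper_pairs r)
      \<le> affine_dim (alternating_space (2 * (r + s))) X"
    unfolding X affine_dim_translate[OF mat_subspace_alternating P sub alt]
    by (rule mat_dim_bullet_ge[OF U(1) V VA])
qed

subsection \<open>Optimal spaces\<close>

lemma mat_space_carrier: "(mat_space r)\<lparr>carrier := carrier_mat r r\<rparr> = mat_space r"
  by (simp add: module_mat_def)

lemma optimal_mat_space_dim_ge:
  assumes "optimal (mat_space r) (\<W> :: 'a::field mat set)"
  shows "card (upper_pairs r) \<le> affine_dim (mat_space r) \<W>"
proof -
  let ?Y = "(+) (1\<^sub>m r) ` strict_upper_mats r :: 'a mat set"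
  note C = mat_subspace_carrier[of r r]
  have "affine_space_of_invertibles (mat_space r) ?Y"
    unfolding affine_space_of_invertibles_iff[OF C, unfolded mat_space_carrier]
    using mat_subspace_strict_upper mat_subspaceD(1)[OF mat_subspace_strict_upper] invertible_unipotent
    by (intro bexI[of _ "1\<^sub>m r"] exI[of _ "strict_upper_mats r"]) auto
  then have "affine_dim (mat_space r) ?Y \<le> affine_dim (mat_space r) \<W>"
    using assms by (simp add: optimal_def)
  moreover have "affine_dim (mat_space r) ?Y = card (upper_pairs r)"
    unfolding mat_dim_strict_upper[where 'a='a, symmetric]
    by (rule affine_dim_translate[OF C, unfolded mat_space_carrier])
      (auto simp: mat_subspace_strict_upper dest: strict_upper_matsD(1))
  ultimately show ?thesis by simp
qed

lemma optimal_alternating_space_dim_ge: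
  assumes "optimal (alternating_space (2 * s)) (\<C> :: 'a::field mat set)"
  shows "s * (s - 1) \<le> affine_dim (alternating_space (2 * s)) \<C>"
proof -
  \<comment> \<open>The sizes are left as \<open>2 * 0\<close> to match the product facts with
    second parameter 0. The 0 x 0 matrix is invertible because its kernel contains only the empty
    vector.\<close>
  let ?Z = "{0\<^sub>m (2 * 0) (2 * 0)} :: 'a mat set"
  let ?Y = "bullet s 0 ((+) (1\<^sub>m s) ` strict_upper_mats s) ((+) (0\<^sub>m (2 * 0) (2 * 0)) ` ?Z)"
  have Z: "mat_subspace (2 * 0) (2 * 0) ?Z" by (auto simp: mat_subspace_def)
  have ZA: "0\<^sub>m (2 * 0) (2 * 0) \<in> (alternating_mats (2 * 0) :: 'a mat set)"
    by (rule mat_subspaceD(2)[OF mat_subspace_alternating])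
  have ZI: "invertible_mat (0\<^sub>m (2 * 0) (2 * 0) + N)" if "N \<in> ?Z" for N
    using that by (auto simp: invertible_mat_iff_trivial_kernel[of _ 0] intro: eq_vecI)
  note Y = bullet_affine_space_of_invertibles[OF one_carrier_mat mat_subspace_strict_upper invertible_unipotent
      ZA Z _ ZI, of s]
  have "affine_space_of_invertibles (alternating_space (2 * s)) ?Y"
    using Y(1) ZA by simp
  then have "affine_dim (alternating_space (2 * s)) ?Y \<le> affine_dim (alternating_space (2 * s)) \<C>"
    using assms by (simp add: optimal_def)
  \<comment> \<open>One half comes from the strictly upper triangular directions, the other from the
    alternating block \<open>D\<close>.\<close>
  moreover have "2 * card (upper_pairs s) \<le> affine_dim (alternating_space (2 * s)) ?Y"
    using Y(2) ZA by (simp add: mat_dim_strict_upper)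
  ultimately show ?thesis by (simp add: card_upper_pairs)
qed

text \<open>Congruence by \<open>P\<close> is linear and injective, preserves alternating matrices
  and multiplies determinants by (det P)^2. So it keeps invertibility and the dimension of the
  direction, the two things that optimality depends on.\<close>

lemma congruent_optimal:
  assumes opt: "optimal (alternating_space k) (X :: 'a::field mat set)" and cong: "congruent_sets k X Y"
  shows "optimal (alternating_space k) Y"
proof -
  note AS = mat_subspace_alternating[of k, where 'a='a]
  from opt obtain p S where p: "p \<in> alternating_mats k" and sub: "mat_subspace k k S" and alt: "S \<subseteq> alternating_mats k"
    and X: "X = (+) p ` S" and inv: "\<And>N. N \<in> S \<Longrightarrow> invertible_mat (p + N)"
    unfolding optimal_def affine_space_of_invertibles_iff[OF AS] by blast
  from cong obtain P where P: "P \<in> carrier_mat k k" "invertible_mat P"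
    and Y: "Y = (\<lambda>A. P * A * transpose_mat P) ` X" unfolding congruent_sets_def by blast
  define f where "f A = P * A * transpose_mat P" for A
  have PT: "transpose_mat P \<in> carrier_mat k k" using P by simp
  have f_add: "f (A + B) = f A + f B" if "A \<in> carrier_mat k k" "B \<in> carrier_mat k k" for A B
    using that P PT unfolding f_def
    by (simp add: mult_add_distrib_mat[of _ k k _ k] add_mult_distrib_mat[of _ k k _ _ k])
  have f_carrier: "f A \<in> carrier_mat k k" if "A \<in> carrier_mat k k" for A
    unfolding f_def by (rule mult_carrier_mat[OF mult_carrier_mat[OF P(1) that] PT])
  have f_alt: "f A \<in> alternating_mats k" if "A \<in> alternating_mats k" for A
    using alternating_mats_congruence[OF that PT] by (simp add: f_def)
  have f_det: "det (f A) = det P * det A * det P" if "A \<in> carrier_mat k k" for A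
    using that P PT by (simp add: f_def det_mult[of _ k] det_transpose)
  have detP: "det P \<noteq> 0" using P invertible_mat_iff_det by blast
  note SC = mat_subspaceD(3)[OF sub] and pC = alternating_matsD(1)[OF p]
  interpret mat_linear k k k k S f
  proof
    fix A c assume A: "A \<in> S"
    show "f A \<in> carrier_mat k k" using SC[OF A] by (rule f_carrier)
    show "f (c \<cdot>\<^sub>m A) = c \<cdot>\<^sub>m f A"
      using SC[OF A] P PT unfolding f_def
      by (simp add: mult_smult_distrib[of _ k k _ k] mult_smult_assoc_mat[of _ k k _ k])
  qed (auto simp: sub intro!: f_add SC)
  have fS: "f ` S \<subseteq> alternating_mats k" using alt f_alt by blast
  have Y_eq: "Y = (+) (f p) ` (f ` S)"
    unfolding Y X image_image by (intro image_cong refl) (simp add: f_add[OF pC SC] flip: f_def)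
  have invY: "\<forall>N\<in>f ` S. invertible_mat (f p + N)"
  proof
    fix N assume "N \<in> f ` S"
    then obtain A where A: "A \<in> S" "N = f A" by blast
    have C: "p + A \<in> carrier_mat k k" using pC SC[OF A(1)] by simp
    have "det (p + A) \<noteq> 0" using inv[OF A(1)] invertible_mat_iff_det[OF C] by simp
    then have "det (f (p + A)) \<noteq> 0" using detP by (simp add: f_det[OF C])
    then show "invertible_mat (f p + N)"
      unfolding A(2) f_add[OF pC SC[OF A(1)], symmetric] invertible_mat_iff_det[OF f_carrier[OF C]] .
  qed
  have affY: "affine_space_of_invertibles (alternating_space k) Y"
    unfolding affine_space_of_invertibles_iff[OF AS]
    using f_alt[OF p] subspace_image fS Y_eq invY by blast
  obtain Q where Q: "Q * P = 1\<^sub>m k" "Q \<in> carrier_mat k k"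
    using det_non_zero_imp_unit[OF P(1) detP, of undefined] by (auto simp: Units_def ring_mat_simps)
  have "mat_dim k k (f ` S) = mat_dim k k S"
  proof (rule dim_image_inj)
    fix A assume A: "A \<in> S" and 0: "f A = 0\<^sub>m k k"
    have QT: "transpose_mat Q \<in> carrier_mat k k" using Q by simp
    have "transpose_mat P * transpose_mat Q = 1\<^sub>m k"
      using transpose_mult[OF Q(2) P(1)] Q(1) by simp
    \<comment> \<open>Congruence by the inverse \<open>Q\<close> undoes \<open>f\<close>, which
      gives injectivity.\<close>
    then have "Q * f A * transpose_mat Q = A"
      using SC[OF A] P PT Q QT unfolding f_def
      by (simp add: assoc_mult_mat[of _ k k _ k _ k] flip: assoc_mult_mat[of Q k k P k _ k])
    moreover have "Q * f A * transpose_mat Q = 0\<^sub>m k k" using 0 Q QT by simp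
    ultimately show "A = 0\<^sub>m k k" by simp
  qed
  then have "affine_dim (alternating_space k) Y = affine_dim (alternating_space k) X"
    unfolding Y_eq X affine_dim_translate[OF AS f_alt[OF p] subspace_image fS]
      affine_dim_translate[OF AS p sub alt] .
  then show ?thesis using opt affY by (simp add: optimal_def)
qed

theorem proposition1p5:
  fixes r s :: nat and \<W> \<C> :: "'a::field mat set"
  assumes "infinite (UNIV :: 'a set) \<or> int (card (UNIV :: 'a set)) > 2 * (int r + int s - 1)"
    and "optimal (mat_space r) \<W>"
    and "optimal (alternating_space (2 * s)) \<C>"
  shows "optimal (alternating_space (2 * (r + s))) (bullet r s \<W> \<C>) \<and>
    (\<forall>Y. Y \<subseteq> alternating_mats (2 * (r + s)) \<and> congruent_sets (2 * (r + s)) (bullet r s \<W> \<C>) Y \<longrightarrow>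
      optimal (alternating_space (2 * (r + s))) Y)"
proof -
  define n where "n = r + s"
  \<comment> \<open>For r = s = 0 the integer bound is negative and the condition is empty; adding 2
    on the other side says the same over the naturals.\<close>
  have card: "infinite (UNIV :: 'a set) \<or> 2 * n < card (UNIV :: 'a set) + 2"
    using assms(1) by (auto simp: n_def)
  note CS = mat_subspace_carrier[of r r, where 'a='a]
  note AS = mat_subspace_alternating[where 'a='a]
  from assms(2) obtain p U where p: "p \<in> carrier_mat r r" and U: "mat_subspace r r U" "U \<subseteq> carrier_mat r r"
    and W: "\<W> = (+) p ` U" and UI: "\<And>N. N \<in> U \<Longrightarrow> invertible_mat (p + N)"
    unfolding optimal_def affine_space_of_invertibles_iff[OF CS, unfolded mat_space_carrier] by blast
  from assms(3) obtain q V where q: "q \<in> alternating_mats (2 * s)" and V: "mat_subspace (2 * s) (2 * s) V"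
      "V \<subseteq> alternating_mats (2 * s)"
    and C: "\<C> = (+) q ` V" and VI: "\<And>N. N \<in> V \<Longrightarrow> invertible_mat (q + N)"
    unfolding optimal_def affine_space_of_invertibles_iff[OF AS] by blast
  note X = bullet_affine_space_of_invertibles[OF p U(1) UI q V VI, folded W C]
  have dimU: "card (upper_pairs r) \<le> mat_dim r r U"
    using optimal_mat_space_dim_ge[OF assms(2)]
    unfolding W affine_dim_translate[OF CS p U, unfolded mat_space_carrier] .
  have dimV: "s * (s - 1) \<le> mat_dim (2 * s) (2 * s) V"
    using optimal_alternating_space_dim_ge[OF assms(3)]
    unfolding C affine_dim_translate[OF AS q V] .
  \<comment> \<open>The block \<open>C\<close> accounts for s(s - 1), \<open>B\<close> for 2sr, and
    r(r - 1) is the sum of two halves, from \<open>M\<close> and from \<open>D\<close>.\<close>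
  have "n * (n - 1) = r * (r - 1) + s * (s - 1) + 2 * s * r"
    by (cases r; cases s) (simp_all add: n_def algebra_simps)
  also have "\<dots> \<le> mat_dim r r U + mat_dim (2 * s) (2 * s) V + 2 * s * r + card (upper_pairs r)"
    using dimU dimV card_upper_pairs[of r] by linarith
  also have "\<dots> \<le> affine_dim (alternating_space (2 * n)) (bullet r s \<W> \<C>)"
    unfolding n_def by (rule X(2))
  finally have ge: "n * (n - 1) \<le> affine_dim (alternating_space (2 * n)) (bullet r s \<W> \<C>)" .
  \<comment> \<open>It suffices to place n(n - 1) between the dimension of any competitor and that
    of the product.\<close>
  have "affine_dim (alternating_space (2 * n)) Y \<le> n * (n - 1)"
    if "affine_space_of_invertibles (alternating_space (2 * n)) Y" for Y :: "'a mat set"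
  proof -
    from that obtain P S where P: "P \<in> alternating_mats (2 * n)" and S: "mat_subspace (2 * n) (2 * n) S"
        "S \<subseteq> alternating_mats (2 * n)"
      and Y: "Y = (+) P ` S" and inv: "\<And>N. N \<in> S \<Longrightarrow> invertible_mat (P + N)"
      unfolding affine_space_of_invertibles_iff[OF AS] by blast
    show ?thesis unfolding Y affine_dim_translate[OF AS P S]
      by (rule dim_alternating_invertible_le[OF card S P inv])
  qed
  then have "optimal (alternating_space (2 * n)) (bullet r s \<W> \<C>)"
    using X(1) ge unfolding optimal_def n_def by (meson order_trans)
  then show ?thesis using congruent_optimal unfolding n_def by blast
qed

end
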